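(* Let $\kappa,\tau\in\mathbb{R}$ and let $\mathsf{C}_\alpha=\pi^{-1}(\alpha)$ be the circular cylinder of radius $\rho$ in $\mathbb{E}(\kappa,\tau)$ over a circle $\alpha$ of $\mathbb{M}^2(\kappa)$ of radius $\rho>0$ centered at the origin $(0,0)$ (with $\rho<\pi/\sqrt{\kappa}$ if $\kappa>0$). Let $L>0$ and let $\mathsf{C}_\alpha(L)=\{(x,y,z)\in\mathsf{C}_\alpha:0\le z\le L\}$ be the truncated piece of length $L$. Define $$L_0=\begin{cases}\dfrac{2\pi}{-\kappa}\sinh(\rho\sqrt{-\kappa})\sqrt{-\kappa+4\tau^2\tanh^2\!\left(\frac{\rho\sqrt{-\kappa}}{2}\right)} & \text{if }\kappa<0,\\[2mm] 2\pi\rho\sqrt{1+\tau^2\rho^2} & \text{if }\kappa=0,\\[2mm] \dfrac{2\pi}{\kappa}\sin(\rho\sqrt{\kappa})\sqrt{\kappa+4\tau^2\tan^2\!\left(\frac{\rho\sqrt{\kappa}}{2}\right)} & \text{if }\kappa>0.\end{cases}$$ Then: (1) $\mathsf{C}_\alpha(L)$ is strongly stable for axially-symmetric variations if and only if $L\le L_0/2$. (2) $\mathsf{C}_\alpha(L)$ is stable for axially-symmetric variations if and only if $L\le L_0$.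
   Context: **The space $\mathbb{E}(\kappa,\tau)$.** Let $\mathcal{R}(\kappa,\tau)=\mathbb{R}^3$ if $\kappa\ge 0$, and $\mathcal{R}(\kappa,\tau)=\{(x,y):x^2+y^2<4/(-\kappa)\}\times\mathbb{R}$ if $\kappa<0$, with coordinates $(x,y,z)$ and Riemannian metric $$g=\sigma^2(dx^2+dy^2)+\big(\sigma\tau(y\,dx-x\,dy)+dz\big)^2,\qquad \sigma=\frac{4}{4+\kappa(x^2+y^2)}.$$ This is the model used for $\mathbb{E}(\kappa,\tau)$, and cylinders are considered inside this model. The map $\pi(x,y,z)=(x,y)$ is a Riemannian submersion onto $\mathbb{M}^2(\kappa)$, the surface with metric $\sigma^2(dx^2+dy^2)$ of constant curvature $\kappa$. **Circular cylinders.** A circle of $\mathbb{M}^2(\kappa)$ is a closed curve of constant geodesic curvature. The circle centered at the origin is $\{x^2+y^2=r^2\}$, $r>0$ (with $r<2/\sqrt{-\kappa}$ if $\kappa<0$); its radius $\rho$ in $\mathbb{M}^2(\kappa)$ is $\frac{2}{\sqrt{-\kappa}}\mathrm{arctanh}\frac{r\sqrt{-\kappa}}{2}$ if $\kappa<0$, $r$ if $\kappa=0$, and $\frac{2}{\sqrt{\kappa}}\arctan\frac{r\sqrt{\kappa}}{2}$ if $\kappa>0$. The circular cylinder of radius $\rho$ is $\mathsf{C}_\alpha=\pi^{-1}(\alpha)$, parametrized by $\psi(s,t)=(r\cos\frac{s}{R},r\sin\frac{s}{R},t)$ with $R=\frac{4r}{4+\kappa r^2}$; it has constant mean curvature. **Stability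 for axially-symmetric variations.** On $\Sigma=\mathsf{C}_\alpha(L)$ with unit normal $N$, let $\mathcal{L}=\Delta+|A|^2+\mathrm{Ric}(N)$ be the Jacobi operator, where $\Delta$ is the Laplacian of $\Sigma$, $A$ its second fundamental form, and $\mathrm{Ric}(N)$ the ambient Ricci curvature in the direction $N$. Let $Q[u]=-\int_\Sigma u\,\mathcal{L}[u]$. A variation is axially symmetric (with respect to the $z$-axis) if its normal component $u$ does not depend on $s$, i.e. $u=u(t)$. The surface $\Sigma$ is strongly stable for axially-symmetric variations if $Q[u]\ge0$ for every smooth $u=u(t)$ on $[0,L]$ with $u(0)=u(L)=0$; it is stable for axially-symmetric variations if $Q[u]\ge 0$ for every such $u$ satisfying in addition $\int_\Sigma u=0$. *)

theory Defs
  imports "HOL-Analysis.Analysis"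
begin

section \<open>Riemannian geometry in coordinates\<close>

text \<open>A metric on an open subset of \<open>\<real>\<^sup>n\<close> is given by its Gram matrix \<open>G p\<close> in the coordinate frame.\<close>

definition pderiv_dir :: "'a::real_normed_vector \<Rightarrow> ('a \<Rightarrow> 'b::real_normed_vector) \<Rightarrow> 'a \<Rightarrow> 'b" where
  "pderiv_dir v f p = vector_derivative (\<lambda>h. f (p + h *\<^sub>R v)) (at 0)"

abbreviation pd :: "'n::finite \<Rightarrow> (real^'n \<Rightarrow> 'b::real_normed_vector) \<Rightarrow> real^'n \<Rightarrow> 'b" where
  "pd i \<equiv> pderiv_dir (axis i 1)"

definition metric_at :: "(real^'n \<Rightarrow> real^'n^'n) \<Rightarrow> real^'n::finite \<Rightarrow> real^'n \<Rightarrow> real^'n \<Rightarrow> real" where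
  "metric_at G p v w = v \<bullet> (G p *v w)"

text \<open>\<open>christoffel G p k i j\<close> is \<open>\<Gamma>\<^sup>k\<close> with lower indices \<open>i, j\<close>, for the Levi-Civita connection.\<close>

definition christoffel :: "(real^'n \<Rightarrow> real^'n^'n) \<Rightarrow> real^'n::finite \<Rightarrow> 'n \<Rightarrow> 'n \<Rightarrow> 'n \<Rightarrow> real" where
  "christoffel G p k i j =
     (\<Sum>l\<in>UNIV. matrix_inv (G p) $ k $ l *
        (pd i (\<lambda>q. G q $ j $ l) p + pd j (\<lambda>q. G q $ i $ l) p - pd l (\<lambda>q. G q $ i $ j) p)) / 2"

text \<open>Ricci tensor as the trace of \<open>X \<mapsto> R(X, \<partial>\<^sub>k) \<partial>\<^sub>j\<close> where
  \<open>R(X,Y) = [\<nabla>\<^sub>X, \<nabla>\<^sub>Y] - \<nabla>\<^bsub>[X,Y]\<^esub>\<close>; it is positive on round spheres.\<close>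

definition ricci :: "(real^'n \<Rightarrow> real^'n^'n) \<Rightarrow> real^'n::finite \<Rightarrow> 'n \<Rightarrow> 'n \<Rightarrow> real" where
  "ricci G p j k =
     (\<Sum>i\<in>UNIV. pd i (\<lambda>q. christoffel G q i j k) p - pd k (\<lambda>q. christoffel G q i i j) p
        + (\<Sum>l\<in>UNIV. christoffel G p i i l * christoffel G p l j k
                   - christoffel G p i k l * christoffel G p l i j))"

definition ricci_curvature :: "(real^'n \<Rightarrow> real^'n^'n) \<Rightarrow> real^'n::finite \<Rightarrow> real^'n \<Rightarrow> real" where
  "ricci_curvature G p v = (\<Sum>j\<in>UNIV. \<Sum>k\<in>UNIV. ricci G p j k * v $ j * v $ k)"


section \<open>Parametrized surfaces\<close>

text \<open>A surface is given by \<open>X :: real \<times> real \<Rightarrow> real^3\<close>; functions and fields on it are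
  functions of the parameters \<open>(s, t)\<close>.  The type \<open>2\<close> indexes the parameters \<open>s\<close> and \<open>t\<close>.\<close>

definition param_dir :: "2 \<Rightarrow> real \<times> real" where
  "param_dir a = (if a = 1 then (1, 0) else (0, 1))"

abbreviation pds :: "2 \<Rightarrow> (real \<times> real \<Rightarrow> 'b::real_normed_vector) \<Rightarrow> real \<times> real \<Rightarrow> 'b" where
  "pds a \<equiv> pderiv_dir (param_dir a)"

definition first_form :: "(real^3 \<Rightarrow> real^3^3) \<Rightarrow> (real \<times> real \<Rightarrow> real^3) \<Rightarrow> real \<times> real \<Rightarrow> real^2^2" where
  "first_form G X q = (\<chi> a b. metric_at G (X q) (pds a X q) (pds b X q))"

definition area_density :: "(real^3 \<Rightarrow> real^3^3) \<Rightarrow> (real \<times> real \<Rightarrow> real^3) \<Rightarrow> real \<times> real \<Rightarrow> real" where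
  "area_density G X q = sqrt (det (first_form G X q))"

definition surface_integral ::
  "(real^3 \<Rightarrow> real^3^3) \<Rightarrow> (real \<times> real \<Rightarrow> real^3) \<Rightarrow> (real \<times> real) set \<Rightarrow> (real \<times> real \<Rightarrow> real) \<Rightarrow> real" where
  "surface_integral G X D f = integral D (\<lambda>q. f q * area_density G X q)"

definition surface_laplacian ::
  "(real^3 \<Rightarrow> real^3^3) \<Rightarrow> (real \<times> real \<Rightarrow> real^3) \<Rightarrow> (real \<times> real \<Rightarrow> real) \<Rightarrow> real \<times> real \<Rightarrow> real" where
  "surface_laplacian G X f q =
     (\<Sum>a\<in>UNIV. pds a (\<lambda>q'. \<Sum>b\<in>UNIV. area_density G X q' * matrix_inv (first_form G X q') $ a $ b
                                     * pds b f q') q) / area_density G X q"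

definition unit_normal ::
  "(real^3 \<Rightarrow> real^3^3) \<Rightarrow> (real \<times> real \<Rightarrow> real^3) \<Rightarrow> (real \<times> real) set \<Rightarrow> (real \<times> real \<Rightarrow> real^3) \<Rightarrow> bool" where
  "unit_normal G X D N \<longleftrightarrow> continuous_on D N \<and>
     (\<forall>q\<in>D. metric_at G (X q) (N q) (N q) = 1 \<and> (\<forall>a. metric_at G (X q) (N q) (pds a X q) = 0))"

text \<open>The ambient covariant derivative of \<open>\<partial>\<^sub>b X\<close> in the direction \<open>\<partial>\<^sub>a X\<close>.\<close>

definition cov_deriv2 ::
  "(real^3 \<Rightarrow> real^3^3) \<Rightarrow> (real \<times> real \<Rightarrow> real^3) \<Rightarrow> 2 \<Rightarrow> 2 \<Rightarrow> real \<times> real \<Rightarrow> real^3" where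
  "cov_deriv2 G X a b q = pds a (pds b X) q +
     (\<chi> k. \<Sum>i\<in>UNIV. \<Sum>j\<in>UNIV. christoffel G (X q) k i j * pds a X q $ i * pds b X q $ j)"

definition second_form ::
  "(real^3 \<Rightarrow> real^3^3) \<Rightarrow> (real \<times> real \<Rightarrow> real^3) \<Rightarrow> (real \<times> real \<Rightarrow> real^3) \<Rightarrow> real \<times> real \<Rightarrow> real^2^2" where
  "second_form G X N q = (\<chi> a b. metric_at G (X q) (cov_deriv2 G X a b q) (N q))"

definition second_form_norm_sq ::
  "(real^3 \<Rightarrow> real^3^3) \<Rightarrow> (real \<times> real \<Rightarrow> real^3) \<Rightarrow> (real \<times> real \<Rightarrow> real^3) \<Rightarrow> real \<times> real \<Rightarrow> real" where
  "second_form_norm_sq G X N q =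
     (let J = matrix_inv (first_form G X q); h = second_form G X N q in
      \<Sum>a\<in>UNIV. \<Sum>b\<in>UNIV. \<Sum>c\<in>UNIV. \<Sum>d\<in>UNIV. J $ a $ c * J $ b $ d * h $ a $ b * h $ c $ d)"

definition jacobi_operator ::
  "(real^3 \<Rightarrow> real^3^3) \<Rightarrow> (real \<times> real \<Rightarrow> real^3) \<Rightarrow> (real \<times> real \<Rightarrow> real^3) \<Rightarrow>
   (real \<times> real \<Rightarrow> real) \<Rightarrow> real \<times> real \<Rightarrow> real" where
  "jacobi_operator G X N f q = surface_laplacian G X f q
     + second_form_norm_sq G X N q * f q + ricci_curvature G (X q) (N q) * f q"

definition index_form ::
  "(real^3 \<Rightarrow> real^3^3) \<Rightarrow> (real \<times> real \<Rightarrow> real^3) \<Rightarrow> (real \<times> real) set \<Rightarrow> (real \<times> real \<Rightarrow> real^3) \<Rightarrow>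
   (real \<times> real \<Rightarrow> real) \<Rightarrow> real" where
  "index_form G X D N f = - surface_integral G X D (\<lambda>q. f q * jacobi_operator G X N f q)"


section \<open>The space E(kappa,tau) and its circular cylinders\<close>

definition E_space :: "real \<Rightarrow> (real^3) set" where
  "E_space \<kappa> = {p. \<kappa> < 0 \<longrightarrow> (p$1)\<^sup>2 + (p$2)\<^sup>2 < 4 / (-\<kappa>)}"

definition E_sigma :: "real \<Rightarrow> real^3 \<Rightarrow> real" where
  "E_sigma \<kappa> p = 4 / (4 + \<kappa> * ((p$1)\<^sup>2 + (p$2)\<^sup>2))"

text \<open>The one-form \<open>\<sigma>\<tau>(y dx - x dy) + dz\<close> at \<open>p\<close>, applied to \<open>v\<close>.\<close>

definition E_form :: "real \<Rightarrow> real \<Rightarrow> real^3 \<Rightarrow> real^3 \<Rightarrow> real" where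
  "E_form \<kappa> \<tau> p v = E_sigma \<kappa> p * \<tau> * (p$2 * v$1 - p$1 * v$2) + v$3"

definition E_metric :: "real \<Rightarrow> real \<Rightarrow> real^3 \<Rightarrow> real^3^3" where
  "E_metric \<kappa> \<tau> p = (\<chi> i j.
     (let v = axis i 1; w = axis j 1 in
      (E_sigma \<kappa> p)\<^sup>2 * (v$1 * w$1 + v$2 * w$2) + E_form \<kappa> \<tau> p v * E_form \<kappa> \<tau> p w))"

text \<open>Radius in the base surface of the circle \<open>x\<^sup>2 + y\<^sup>2 = r\<^sup>2\<close>.\<close>

definition circle_radius :: "real \<Rightarrow> real \<Rightarrow> real" where
  "circle_radius \<kappa> r =
     (if \<kappa> < 0 then 2 / sqrt (-\<kappa>) * artanh (r * sqrt (-\<kappa>) / 2)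
      else if \<kappa> = 0 then r
      else 2 / sqrt \<kappa> * arctan (r * sqrt \<kappa> / 2))"

definition base_circle :: "real \<Rightarrow> real \<Rightarrow> (real \<times> real) set" where
  "base_circle \<kappa> \<rho> =
     {q. 0 < norm q \<and> (\<kappa> < 0 \<longrightarrow> norm q < 2 / sqrt (-\<kappa>)) \<and> circle_radius \<kappa> (norm q) = \<rho>}"

definition truncated_cylinder :: "real \<Rightarrow> real \<Rightarrow> real \<Rightarrow> (real^3) set" where
  "truncated_cylinder \<kappa> \<rho> L = {p \<in> E_space \<kappa>. (p$1, p$2) \<in> base_circle \<kappa> \<rho> \<and> 0 \<le> p$3 \<and> p$3 \<le> L}"

definition cyl_R :: "real \<Rightarrow> real \<Rightarrow> real" where
  "cyl_R \<kappa> r = 4 * r / (4 + \<kappa> * r\<^sup>2)"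

definition cyl_param :: "real \<Rightarrow> real \<Rightarrow> real \<times> real \<Rightarrow> real^3" where
  "cyl_param \<kappa> r = (\<lambda>(s, t). vector [r * cos (s / cyl_R \<kappa> r), r * sin (s / cyl_R \<kappa> r), t])"

definition cyl_domain :: "real \<Rightarrow> real \<Rightarrow> real \<Rightarrow> (real \<times> real) set" where
  "cyl_domain \<kappa> r L = {0 .. 2 * pi * cyl_R \<kappa> r} \<times> {0 .. L}"

lemma cyl_denom_pos:
  assumes "0 < r" "\<kappa> < 0 \<longrightarrow> r < 2 / sqrt (-\<kappa>)"
  shows "0 < 4 + \<kappa> * r\<^sup>2"
proof (cases "\<kappa> < 0")
  case True
  then have "r * sqrt (-\<kappa>) < 2"
    using assms by (simp add: field_simps)
  then have "(r * sqrt (-\<kappa>))\<^sup>2 < 2\<^sup>2"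
    using assms(1) True by (intro power_strict_mono) auto
  then show ?thesis
    using True by (simp add: power_mult_distrib algebra_simps)
next
  case False
  then show ?thesis by (simp add: add_pos_nonneg)
qed

lemma artanh_real_inj:
  fixes a b :: real
  assumes "\<bar>a\<bar> < 1" "\<bar>b\<bar> < 1" "artanh a = artanh b"
  shows "a = b"
proof -
  have "0 < (1 + a) / (1 - a)" "0 < (1 + b) / (1 - b)"
    using assms by (auto intro!: divide_pos_pos)
  moreover have "ln ((1 + a) / (1 - a)) = ln ((1 + b) / (1 - b))"
    using assms(3) by (simp add: artanh_def)
  ultimately have "(1 + a) / (1 - a) = (1 + b) / (1 - b)"
    using ln_inj_iff by blast
  then have "(1 + a) * (1 - b) = (1 + b) * (1 - a)"
    using assms by (simp add: frac_eq_eq)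
  then show ?thesis by (simp add: algebra_simps)
qed

lemma circle_radius_inj:
  assumes "0 < r" "\<kappa> < 0 \<longrightarrow> r < 2 / sqrt (-\<kappa>)"
    and "0 < r'" "\<kappa> < 0 \<longrightarrow> r' < 2 / sqrt (-\<kappa>)"
    and eq: "circle_radius \<kappa> r = circle_radius \<kappa> r'"
  shows "r = r'"
proof -
  consider "\<kappa> < 0" | "\<kappa> = 0" | "\<kappa> > 0" by linarith
  then show ?thesis
  proof cases
    case 1
    have b: "\<bar>x * sqrt (-\<kappa>) / 2\<bar> < 1" if "0 < x" "x < 2 / sqrt (-\<kappa>)" for x
      using that 1 by (simp add: field_simps abs_mult)
    have "artanh (r * sqrt (-\<kappa>) / 2) = artanh (r' * sqrt (-\<kappa>) / 2)"
      using eq 1 by (simp add: circle_radius_def)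
    then have "r * sqrt (-\<kappa>) / 2 = r' * sqrt (-\<kappa>) / 2"
      using b[of r] b[of r'] assms(1-4) 1 artanh_real_inj by blast
    then show ?thesis using 1 by simp
  next
    case 2
    then show ?thesis using eq by (simp add: circle_radius_def)
  next
    case 3
    then have "arctan (r * sqrt \<kappa> / 2) = arctan (r' * sqrt \<kappa> / 2)"
      using eq by (simp add: circle_radius_def)
    then have "r * sqrt \<kappa> / 2 = r' * sqrt \<kappa> / 2" by (simp add: arctan_eq_iff)
    then show ?thesis using 3 by simp
  qed
qed

text \<open>The parametrized patch is the truncated cylinder, covered once up to the closing edge.\<close>

lemma cyl_param_image:
  assumes r: "0 < r" "\<kappa> < 0 \<longrightarrow> r < 2 / sqrt (-\<kappa>)"
  shows "cyl_param \<kappa> r ` cyl_domain \<kappa> r L = truncated_cylinder \<kappa> (circle_radius \<kappa> r) L"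
proof
  have R: "cyl_R \<kappa> r > 0"
    using cyl_denom_pos[OF r] r(1) by (simp add: cyl_R_def)
  show "cyl_param \<kappa> r ` cyl_domain \<kappa> r L \<subseteq> truncated_cylinder \<kappa> (circle_radius \<kappa> r) L"
  proof
    fix p assume "p \<in> cyl_param \<kappa> r ` cyl_domain \<kappa> r L"
    then obtain s t where st: "0 \<le> t" "t \<le> L" and p: "p = cyl_param \<kappa> r (s, t)"
      by (auto simp: cyl_domain_def)
    have sq: "(p$1)\<^sup>2 + (p$2)\<^sup>2 = r\<^sup>2"
      unfolding p by (simp add: cyl_param_def cos_squared_eq algebra_simps)
    then have n: "norm (p$1, p$2) = r" using r(1) by (simp add: norm_Pair)
    have "r\<^sup>2 < 4 / (-\<kappa>)" if "\<kappa> < 0"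
      using cyl_denom_pos[OF r] that by (simp add: field_simps)
    then have "p \<in> E_space \<kappa>" by (simp add: E_space_def sq)
    moreover have "(p$1, p$2) \<in> base_circle \<kappa> (circle_radius \<kappa> r)"
      unfolding base_circle_def using r by (simp add: n del: zero_less_norm_iff)
    moreover have "p$3 = t" by (simp add: p cyl_param_def)
    ultimately show "p \<in> truncated_cylinder \<kappa> (circle_radius \<kappa> r) L"
      using st by (simp add: truncated_cylinder_def)
  qed
  show "truncated_cylinder \<kappa> (circle_radius \<kappa> r) L \<subseteq> cyl_param \<kappa> r ` cyl_domain \<kappa> r L"
  proof
    fix p assume p: "p \<in> truncated_cylinder \<kappa> (circle_radius \<kappa> r) L"
    have "norm (p$1, p$2) = r"
    proof (rule circle_radius_inj)
      have c: "(p$1, p$2) \<in> base_circle \<kappa> (circle_radius \<kappa> r)"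
        using p by (simp add: truncated_cylinder_def)
      show "0 < norm (p$1, p$2)" "\<kappa> < 0 \<longrightarrow> norm (p$1, p$2) < 2 / sqrt (-\<kappa>)"
        "circle_radius \<kappa> (norm (p$1, p$2)) = circle_radius \<kappa> r"
        using c unfolding base_circle_def by blast+
    qed (use r in auto)
    then have "sqrt ((p$1)\<^sup>2 + (p$2)\<^sup>2) = r" by (simp add: norm_Pair)
    then have sq: "(p$1)\<^sup>2 + (p$2)\<^sup>2 = r\<^sup>2" by (metis real_sqrt_pow2 sum_power2_ge_zero)
    then have "(p$1 / r)\<^sup>2 + (p$2 / r)\<^sup>2 = 1"
      using r(1) by (simp add: power_divide add_divide_distrib[symmetric])
    then obtain \<theta> where \<theta>: "0 \<le> \<theta>" "\<theta> < 2 * pi" "p$1 / r = cos \<theta>" "p$2 / r = sin \<theta>"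
      using sincos_total_2pi[of "p$1 / r" "p$2 / r"] by blast
    have "p$1 = r * cos \<theta>" "p$2 = r * sin \<theta>"
      using r(1) by (simp_all flip: \<theta>(3,4))
    then have "p = cyl_param \<kappa> r (cyl_R \<kappa> r * \<theta>, p$3)"
      using R by (simp add: cyl_param_def vec_eq_iff forall_3)
    moreover have "(cyl_R \<kappa> r * \<theta>, p$3) \<in> cyl_domain \<kappa> r L"
      using p \<theta> R by (auto simp: cyl_domain_def truncated_cylinder_def)
    ultimately show "p \<in> cyl_param \<kappa> r ` cyl_domain \<kappa> r L" by blast
  qed
qed

lemma cyl_param_inj:
  assumes r: "0 < r" "\<kappa> < 0 \<longrightarrow> r < 2 / sqrt (-\<kappa>)"
  shows "inj_on (cyl_param \<kappa> r) ({0 ..< 2 * pi * cyl_R \<kappa> r} \<times> UNIV)"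
proof -
  have R: "cyl_R \<kappa> r > 0"
    using cyl_denom_pos[OF r] r(1) by (simp add: cyl_R_def)
  have *: "s = s' \<and> t = t'"
    if s: "0 \<le> s" "s < 2 * pi * cyl_R \<kappa> r" "0 \<le> s'" "s' < 2 * pi * cyl_R \<kappa> r"
      and eq: "cyl_param \<kappa> r (s, t) = cyl_param \<kappa> r (s', t')" for s s' t t'
  proof -
    have e: "cos (s / cyl_R \<kappa> r) = cos (s' / cyl_R \<kappa> r)" "sin (s / cyl_R \<kappa> r) = sin (s' / cyl_R \<kappa> r)" "t = t'"
      using eq r(1) by (simp_all add: cyl_param_def vec_eq_iff forall_3)
    then obtain n :: int where n: "s / cyl_R \<kappa> r = s' / cyl_R \<kappa> r + 2 * pi * n"
      using sin_cos_eq_iff[of "s / cyl_R \<kappa> r" "s' / cyl_R \<kappa> r"] by blast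
    then have d: "s - s' = 2 * pi * cyl_R \<kappa> r * n" using R by (simp add: field_simps)
    have "\<bar>s - s'\<bar> < 2 * pi * cyl_R \<kappa> r" using s by linarith
    then have "\<bar>real_of_int n\<bar> < 1" using d R by (simp add: abs_mult)
    then have "n = 0" by linarith
    then have "s = s'" using d by simp
    then show ?thesis using e(3) by blast
  qed
  show ?thesis
  proof (rule inj_onI)
    fix p q assume "p \<in> {0 ..< 2 * pi * cyl_R \<kappa> r} \<times> (UNIV :: real set)"
      "q \<in> {0 ..< 2 * pi * cyl_R \<kappa> r} \<times> (UNIV :: real set)" "cyl_param \<kappa> r p = cyl_param \<kappa> r q"
    then show "p = q"
      using *[of "fst p" "fst q" "snd p" "snd q"] by (simp add: mem_Times_iff prod_eq_iff)
  qed
qed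


section \<open>Stability for axially-symmetric variations\<close>

text \<open>\<open>C\<^sup>\<infinity>\<close> on the closed interval \<open>[0, L]\<close>, with one-sided derivatives at the endpoints.
  Values of \<open>u\<close> outside \<open>[0, L]\<close> are irrelevant: they only influence the Jacobi operator on the
  edges \<open>t = 0\<close> and \<open>t = L\<close>, a null set.\<close>

definition smooth_on_interval :: "real \<Rightarrow> (real \<Rightarrow> real) \<Rightarrow> bool" where
  "smooth_on_interval L u \<longleftrightarrow> (\<exists>D :: nat \<Rightarrow> real \<Rightarrow> real. (\<forall>t\<in>{0..L}. D 0 t = u t) \<and>
     (\<forall>n. \<forall>t\<in>{0..L}. (D n has_real_derivative D (Suc n) t) (at t within {0..L})))"

definition axial_test :: "real \<Rightarrow> (real \<Rightarrow> real) \<Rightarrow> bool" where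
  "axial_test L u \<longleftrightarrow> smooth_on_interval L u \<and> u 0 = 0 \<and> u L = 0"

text \<open>The surface is the patch \<open>cyl_param \<kappa> r\<close> on \<open>cyl_domain \<kappa> r L\<close>, with unit normal \<open>N\<close>.\<close>

definition strongly_stable_axial :: "real \<Rightarrow> real \<Rightarrow> real \<Rightarrow> real \<Rightarrow> (real \<times> real \<Rightarrow> real^3) \<Rightarrow> bool" where
  "strongly_stable_axial \<kappa> \<tau> r L N \<longleftrightarrow>
     (\<forall>u. axial_test L u \<longrightarrow>
        0 \<le> index_form (E_metric \<kappa> \<tau>) (cyl_param \<kappa> r) (cyl_domain \<kappa> r L) N (\<lambda>(s, t). u t))"

definition stable_axial :: "real \<Rightarrow> real \<Rightarrow> real \<Rightarrow> real \<Rightarrow> (real \<times> real \<Rightarrow> real^3) \<Rightarrow> bool" where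
  "stable_axial \<kappa> \<tau> r L N \<longleftrightarrow>
     (\<forall>u. axial_test L u \<and>
          surface_integral (E_metric \<kappa> \<tau>) (cyl_param \<kappa> r) (cyl_domain \<kappa> r L) (\<lambda>(s, t). u t) = 0 \<longrightarrow>
        0 \<le> index_form (E_metric \<kappa> \<tau>) (cyl_param \<kappa> r) (cyl_domain \<kappa> r L) N (\<lambda>(s, t). u t))"

definition L0 :: "real \<Rightarrow> real \<Rightarrow> real \<Rightarrow> real" where
  "L0 \<kappa> \<tau> \<rho> =
     (if \<kappa> < 0 then 2 * pi / (-\<kappa>) * sinh (\<rho> * sqrt (-\<kappa>))
                     * sqrt (-\<kappa> + 4 * \<tau>\<^sup>2 * (tanh (\<rho> * sqrt (-\<kappa>) / 2))\<^sup>2)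
      else if \<kappa> = 0 then 2 * pi * \<rho> * sqrt (1 + \<tau>\<^sup>2 * \<rho>\<^sup>2)
      else 2 * pi / \<kappa> * sin (\<rho> * sqrt \<kappa>) * sqrt (\<kappa> + 4 * \<tau>\<^sup>2 * (tan (\<rho> * sqrt \<kappa> / 2))\<^sup>2))"

end

(* In the orthonormal frame of the cylinder given by its horizontal unit tangent and the vertical
   field, the second fundamental form is [[k, tau], [tau, 0]] up to sign, with k the geodesic curvature
   of the circle, and Ric(N) = kappa - 2 tau^2 because N is horizontal. Hence |A|^2 + Ric(N) =
   k^2 + kappa = 1/R^2 is constant. On functions u(t) the Laplacian is (1 + tau^2 r^2) u'', and so
   Q[u] = 2 pi R (c int u'^2 - R^(-2) int u^2) with c = 1 + tau^2 r^2, while L_0 = 2 pi R sqrt c.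
   Both equivalences are then sharp Wirtinger inequalities: the constant is (pi/L)^2 for u vanishing at
   both ends, and (2 pi/L)^2 for periodic u of mean zero; the extremals sin(pi t/L) and
   sin(2 pi t/L) show instability beyond the bounds. *)
theory Submission
  imports Defs
begin

text \<open>The Christoffel symbols and the Ricci tensor are computed entry by entry from their
  coordinate definitions. This stays feasible because all entries are polynomials in x, y, \<tau>, S
  = \<open>E_sigma \<kappa> p\<close> and a = \<kappa> S: derivatives of S are again of this kind,
  and the only relation, S (4 + \<kappa> (x^2 + y^2)) = 4, becomes a rewrite rule for a x^2. The
  parametrization is not adapted to the orthonormal frame: its s-direction has vertical component
  -\<tau> r. This makes the first form non-diagonal with determinant 1, and c = 1 + \<tau>^2 r^2 is
  the (t,t) entry of its inverse, the squared gradient of t. The Wirtinger inequalities avoid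
  Fourier series. A Riccati weight, the logarithmic derivative of cos (k (t - m)), completes a
  square, but at the sharp constant it blows up at the ends of the interval; hence the inequality is
  shown for every smaller k and passed to the limit.\<close>

section \<open>Directional derivatives and inverse matrices\<close>

text \<open>\<open>pderiv_dir\<close> rests on \<open>vector_derivative\<close>, a choice that is
  controlled only where a derivative exists. A Frechet derivative at \<open>p\<close> supplies it in
  every direction, which is why the arithmetic rules below carry differentiability
  hypotheses.\<close>

lemma pderiv_dir_eqI:
  assumes "(f has_derivative f') (at p)"
  shows "pderiv_dir v f p = f' v"
proof -
  have 1: "((\<lambda>h. p + h *\<^sub>R v) has_derivative (\<lambda>h. h *\<^sub>R v)) (at 0)"
    by (auto intro!: derivative_eq_intros)
  have "((\<lambda>h. f (p + h *\<^sub>R v)) has_derivative (\<lambda>h. f' (h *\<^sub>R v))) (at 0)"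
    by (rule has_derivative_compose[OF 1]) (use assms in simp)
  then have "((\<lambda>h. f (p + h *\<^sub>R v)) has_vector_derivative f' v) (at 0)"
    unfolding has_vector_derivative_def
    using linear_scale[OF has_derivative_linear[OF assms]] by simp
  then show ?thesis
    unfolding pderiv_dir_def by (rule vector_derivative_at)
qed

lemma pderiv_dir_cong_open:
  assumes "open S" "p \<in> S" "\<And>q. q \<in> S \<Longrightarrow> f q = g q"
  shows "pderiv_dir v f p = pderiv_dir v g p"
  unfolding pderiv_dir_def
proof (rule vector_derivative_cong_eq)
  have "((\<lambda>h. p + h *\<^sub>R v) \<longlongrightarrow> p + 0 *\<^sub>R v) (nhds 0)"
    by (intro tendsto_intros filterlim_ident)
  then have "\<forall>\<^sub>F h in nhds 0. p + h *\<^sub>R v \<in> S"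
    using assms(1,2) by (auto dest!: topological_tendstoD)
  then show "\<forall>\<^sub>F h in nhds 0. h \<in> UNIV \<longrightarrow> f (p + h *\<^sub>R v) = g (p + h *\<^sub>R v)"
    by eventually_elim (simp add: assms(3))
qed auto

lemma pderiv_dir_const: "pderiv_dir v (\<lambda>q. c) p = 0"
  using pderiv_dir_eqI[OF has_derivative_const] by blast

lemma pderiv_dir_nth: "pderiv_dir v (\<lambda>q. q $ i) p = v $ i"
  by (rule pderiv_dir_eqI) (rule bounded_linear_imp_has_derivative[OF bounded_linear_vec_nth])

lemma
  fixes f g :: "'a::real_normed_vector \<Rightarrow> 'b::real_normed_vector"
  assumes "f differentiable at p"
  shows pderiv_dir_minus: "pderiv_dir v (\<lambda>q. - f q) p = - pderiv_dir v f p"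
    and pderiv_dir_add: "g differentiable at p \<Longrightarrow>
      pderiv_dir v (\<lambda>q. f q + g q) p = pderiv_dir v f p + pderiv_dir v g p"
    and pderiv_dir_diff: "g differentiable at p \<Longrightarrow>
      pderiv_dir v (\<lambda>q. f q - g q) p = pderiv_dir v f p - pderiv_dir v g p"
proof -
  obtain f' where f: "(f has_derivative f') (at p)"
    using assms unfolding differentiable_def by blast
  show "pderiv_dir v (\<lambda>q. - f q) p = - pderiv_dir v f p"
    using pderiv_dir_eqI[OF has_derivative_minus[OF f]] pderiv_dir_eqI[OF f] by simp
  show "pderiv_dir v (\<lambda>q. f q + g q) p = pderiv_dir v f p + pderiv_dir v g p"
    "pderiv_dir v (\<lambda>q. f q - g q) p = pderiv_dir v f p - pderiv_dir v g p"
    if dg: "g differentiable at p"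
  proof -
    obtain g' where g: "(g has_derivative g') (at p)"
      using dg unfolding differentiable_def by blast
    show "pderiv_dir v (\<lambda>q. f q + g q) p = pderiv_dir v f p + pderiv_dir v g p"
      "pderiv_dir v (\<lambda>q. f q - g q) p = pderiv_dir v f p - pderiv_dir v g p"
      using pderiv_dir_eqI[OF has_derivative_add[OF f g]] pderiv_dir_eqI[OF has_derivative_diff[OF f g]]
        pderiv_dir_eqI[OF f] pderiv_dir_eqI[OF g] by simp_all
  qed
qed

lemma
  fixes f g :: "'a::real_normed_vector \<Rightarrow> real"
  assumes "f differentiable at p"
  shows pderiv_dir_mult: "g differentiable at p \<Longrightarrow>
      pderiv_dir v (\<lambda>q. f q * g q) p = f p * pderiv_dir v g p + pderiv_dir v f p * g p"
    and pderiv_dir_power: "pderiv_dir v (\<lambda>q. f q ^ n) p = of_nat n * pderiv_dir v f p * f p ^ (n - 1)"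
    and pderiv_dir_divide_const: "pderiv_dir v (\<lambda>q. f q / c) p = pderiv_dir v f p / c"
proof -
  obtain f' where f: "(f has_derivative f') (at p)"
    using assms unfolding differentiable_def by blast
  show "pderiv_dir v (\<lambda>q. f q * g q) p = f p * pderiv_dir v g p + pderiv_dir v f p * g p"
    if dg: "g differentiable at p"
  proof -
    obtain g' where g: "(g has_derivative g') (at p)"
      using dg unfolding differentiable_def by blast
    show ?thesis
      using pderiv_dir_eqI[OF has_derivative_mult[OF f g]] pderiv_dir_eqI[OF f] pderiv_dir_eqI[OF g]
      by simp
  qed
  show "pderiv_dir v (\<lambda>q. f q ^ n) p = of_nat n * pderiv_dir v f p * f p ^ (n - 1)"
    using pderiv_dir_eqI[OF has_derivative_power[OF f]] pderiv_dir_eqI[OF f] by (simp add: mult_ac)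
  have "((\<lambda>q. f q / c) has_derivative (\<lambda>h. f' h / c)) (at p)"
    using f by (auto intro!: derivative_eq_intros simp: divide_inverse)
  then show "pderiv_dir v (\<lambda>q. f q / c) p = pderiv_dir v f p / c"
    using pderiv_dir_eqI pderiv_dir_eqI[OF f] by metis
qed

lemmas pderiv_dir_simps =
  pderiv_dir_const pderiv_dir_nth pderiv_dir_add pderiv_dir_diff pderiv_dir_minus
  pderiv_dir_mult pderiv_dir_power pderiv_dir_divide_const

lemma matrix_inv_eqI:
  fixes A B :: "'a::semiring_1^'n^'n"
  assumes "A ** B = mat 1" "B ** A = mat 1"
  shows "matrix_inv A = B"
proof -
  have "A ** matrix_inv A = mat 1 \<and> matrix_inv A ** A = mat 1"
    unfolding matrix_inv_def by (rule someI[of _ B]) (use assms in simp)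
  then show ?thesis
    using assms by (metis matrix_mul_assoc matrix_mul_lid matrix_mul_rid)
qed

section \<open>Curvature of the ambient space\<close>

text \<open>The curvature identities are rational, so they hold wherever the denominator of
  \<open>E_sigma\<close> is nonzero; for \<kappa> < 0 this includes the exterior of the disc of the
  model. Openness allows them to be differentiated.\<close>

definition E_chart :: "real \<Rightarrow> (real^3) set" where
  "E_chart \<kappa> = {p. 4 + \<kappa> * ((p$1)\<^sup>2 + (p$2)\<^sup>2) \<noteq> 0}"

lemma open_E_chart: "open (E_chart \<kappa>)"
  unfolding E_chart_def by (intro open_Collect_neq continuous_intros)

lemma E_sigma_relation:
  assumes "p \<in> E_chart \<kappa>"
  shows "E_sigma \<kappa> p * (4 + \<kappa> * ((p$1)\<^sup>2 + (p$2)\<^sup>2)) = 4" "E_sigma \<kappa> p \<noteq> 0"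
proof -
  have "4 / D * D = 4" if "D \<noteq> 0" for D :: real using that by simp
  then show "E_sigma \<kappa> p * (4 + \<kappa> * ((p$1)\<^sup>2 + (p$2)\<^sup>2)) = 4"
    using assms unfolding E_chart_def E_sigma_def by blast
  then show "E_sigma \<kappa> p \<noteq> 0" by auto
qed

lemma has_derivative_E_sigma:
  assumes "p \<in> E_chart \<kappa>"
  shows "(E_sigma \<kappa> has_derivative
    (\<lambda>v. - \<kappa> * (E_sigma \<kappa> p)\<^sup>2 / 2 * (p$1 * v$1 + p$2 * v$2))) (at p)"
proof -
  define D where "D q = 4 + \<kappa> * ((q$1)\<^sup>2 + (q$2)\<^sup>2)" for q :: "real^3"
  have nz: "D p \<noteq> 0" using assms by (simp add: E_chart_def D_def)
  have [derivative_intros]: "((\<lambda>q. q $ i) has_derivative (\<lambda>v. v $ i)) (at p)" for i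
    by (rule bounded_linear_imp_has_derivative[OF bounded_linear_vec_nth])
  have "(D has_derivative (\<lambda>v. 2 * \<kappa> * (p$1 * v$1 + p$2 * v$2))) (at p)"
    unfolding D_def[abs_def]
    by (auto intro!: derivative_eq_intros simp: fun_eq_iff algebra_simps)
  from has_derivative_divide[OF has_derivative_const[of 4] this nz]
  have "((\<lambda>q. 4 / D q) has_derivative (\<lambda>v. - \<kappa> * (4 / D p)\<^sup>2 / 2 * (p$1 * v$1 + p$2 * v$2))) (at p)"
    by (rule has_derivative_eq_rhs) (auto simp: fun_eq_iff nz field_simps power2_eq_square)
  moreover have "E_sigma \<kappa> = (\<lambda>q. 4 / D q)" by (simp add: fun_eq_iff E_sigma_def D_def)
  ultimately show ?thesis by simp
qed

lemma differentiable_E_sigma: "p \<in> E_chart \<kappa> \<Longrightarrow> E_sigma \<kappa> differentiable at p"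
  using has_derivative_E_sigma differentiable_def by blast

lemma differentiable_vec_nth: "(\<lambda>q. q $ i) differentiable at p"
  using bounded_linear_imp_has_derivative[OF bounded_linear_vec_nth] differentiable_def by blast

lemma pderiv_dir_E_sigma:
  "p \<in> E_chart \<kappa> \<Longrightarrow> pderiv_dir v (E_sigma \<kappa>) p = - \<kappa> * (E_sigma \<kappa> p)\<^sup>2 / 2 * (p$1 * v$1 + p$2 * v$2)"
  by (rule pderiv_dir_eqI[OF has_derivative_E_sigma])

lemmas E_deriv_simps = pderiv_dir_simps differentiable_E_sigma
  differentiable_vec_nth differentiable_mult differentiable_power differentiable_add differentiable_diff
  differentiable_minus differentiable_const

lemma E_metric_eq:
  "E_metric \<kappa> \<tau> p = (let S = E_sigma \<kappa> p; A = \<tau> * S * p$2; B = - (\<tau> * S * p$1) in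
     vector [vector [S\<^sup>2 + A\<^sup>2, A * B, A], vector [A * B, S\<^sup>2 + B\<^sup>2, B], vector [A, B, 1]])"
  by (simp add: vec_eq_iff forall_3 E_metric_def E_form_def axis_def Let_def power2_eq_square algebra_simps)

text \<open>With A, B the horizontal coefficients of \<open>E_form\<close>, the vectors (1, 0,
  -A)/S, (0, 1, -B)/S and (0, 0, 1) form an orthonormal frame; the inverse Gram matrix is the sum of
  their outer squares.\<close>

lemma matrix_inv_E_metric:
  assumes "p \<in> E_chart \<kappa>"
  shows "matrix_inv (E_metric \<kappa> \<tau> p) = (let S = E_sigma \<kappa> p; T = \<tau> / S in
     vector [vector [1 / S\<^sup>2, 0, - (T * p$2)], vector [0, 1 / S\<^sup>2, T * p$1],
       vector [- (T * p$2), T * p$1, 1 + \<tau>\<^sup>2 * ((p$1)\<^sup>2 + (p$2)\<^sup>2)]])"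
  using E_sigma_relation(2)[OF assms]
  by (intro matrix_inv_eqI)
     (simp_all add: E_metric_eq Let_def vec_eq_iff forall_3 matrix_matrix_mult_def sum_3 mat_def
       power2_eq_square field_simps)

text \<open>The Christoffel symbols with upper index \<open>k\<close>.  Here \<open>P\<close>, \<open>Q\<close> are the partial derivatives of
  \<open>ln \<sigma>\<close>, \<open>A\<close>, \<open>B\<close> the horizontal coefficients of the one-form \<open>\<omega>\<close> = \<open>E_form\<close>, and \<open>U\<close>, \<open>V\<close> come from
  its symmetrized derivative; for \<open>k = 3\<close> they follow from \<open>\<omega>(\<nabla>\<^sub>i \<partial>\<^sub>j) = (\<partial>\<^sub>i \<omega>\<^sub>j + \<partial>\<^sub>j \<omega>\<^sub>i) / 2\<close>.\<close>

definition E_gamma :: "real \<Rightarrow> real \<Rightarrow> real^3 \<Rightarrow> 3 \<Rightarrow> 3 \<Rightarrow> 3 \<Rightarrow> real" where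
  "E_gamma \<kappa> \<tau> q k i j =
    (let x = q$1; y = q$2; S = E_sigma \<kappa> q; a = \<kappa> * S; P = - (a * x) / 2; Q = - (a * y) / 2;
       A = \<tau> * S * y; B = - (\<tau> * S * x); U = \<tau> * a * S * (x * y) / 2; V = \<tau> * a * S * (x^2 - y^2) / 4
     in if k = 1 then
       if i = 1 then if j = 1 then P else if j = 2 then Q + \<tau> * A else 0
       else if i = 2 then if j = 1 then Q + \<tau> * A else if j = 2 then - P + 2 * \<tau> * B else \<tau>
       else if j = 2 then \<tau> else 0
     else if k = 2 then
       if i = 1 then if j = 1 then - Q - 2 * \<tau> * A else if j = 2 then P - \<tau> * B else - \<tau>
       else if i = 2 then if j = 1 then P - \<tau> * B else if j = 2 then Q else 0
       else if j = 1 then - \<tau> else 0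
     else
       if i = 1 then if j = 1 then - U - A * P + B * (Q + 2 * \<tau> * A)
         else if j = 2 then V - A * (Q + \<tau> * A) - B * (P - \<tau> * B) else \<tau> * B
       else if i = 2 then if j = 1 then V - A * (Q + \<tau> * A) - B * (P - \<tau> * B)
         else if j = 2 then U + A * (P - 2 * \<tau> * B) - B * Q else - \<tau> * A
       else if j = 1 then \<tau> * B else if j = 2 then - \<tau> * A else 0)"

lemma christoffel_E_metric:
  assumes "p \<in> E_chart \<kappa>"
  shows "christoffel (E_metric \<kappa> \<tau>) p k i j = E_gamma \<kappa> \<tau> p k i j"
proof -
  define S x y where S: "S = E_sigma \<kappa> p" and x: "x = p$1" and y: "y = p$2"
  have rel: "S * (4 + \<kappa> * (x\<^sup>2 + y\<^sup>2)) = 4" and nz: "S \<noteq> 0"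
    using E_sigma_relation[OF assms] by (simp_all add: S x y)
  define a where "a = \<kappa> * S"
  \<comment> \<open>The relation between \<open>S\<close>, \<open>\<kappa>\<close>, \<open>x\<close>, \<open>y\<close> becomes linear in \<open>S\<close> when \<open>a = \<kappa> S\<close> replaces \<open>\<kappa>\<close>;
    oriented as below it terminates as a rewrite rule on polynomials in \<open>S, a, x, y\<close>.\<close>
  have ax: "a * (x * x) = 4 - 4 * S - a * (y * y)"
    using rel by (simp add: a_def field_simps power2_eq_square)
  have axz: "a * (x * (x * z)) = (4 - 4 * S) * z - a * (y * (y * z))" for z
    using arg_cong[OF ax, of "\<lambda>c. c * z"] by (simp add: algebra_simps)
  have dS: "pderiv_dir v (E_sigma \<kappa>) p = - (a * S) / 2 * (x * v$1 + y * v$2)" for v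
    using assms by (simp add: pderiv_dir_E_sigma a_def S x y power2_eq_square)
  note * = E_metric_eq Let_def dS E_deriv_simps assms axis_def
   S[symmetric] x[symmetric] y[symmetric] a_def[symmetric]
  have "\<forall>k i j. christoffel (E_metric \<kappa> \<tau>) p k i j = E_gamma \<kappa> \<tau> p k i j"
    unfolding forall_3 christoffel_def sum_3 matrix_inv_E_metric[OF assms]
    by (intro conjI; simp add: E_gamma_def *)
       (simp_all add: nz field_simps power2_eq_square, simp_all add: ax axz ring_distribs mult_ac)
  then show ?thesis by blast
qed

text \<open>A derivative at \<open>p\<close> needs the closed form on a neighbourhood of
  \<open>p\<close>, not just at \<open>p\<close>.\<close>

lemma pderiv_dir_christoffel_E_metric:
  assumes "p \<in> E_chart \<kappa>"
  shows "pderiv_dir v (\<lambda>q. christoffel (E_metric \<kappa> \<tau>) q k i j) p =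
    pderiv_dir v (\<lambda>q. E_gamma \<kappa> \<tau> q k i j) p"
  by (rule pderiv_dir_cong_open[OF open_E_chart assms]) (rule christoffel_E_metric)

text \<open>Vertical translations are isometries, so nothing depends on the third
  coordinate.\<close>

lemma pd_3_E_gamma: "pd 3 (\<lambda>q. E_gamma \<kappa> \<tau> q k i j) p = 0"
proof -
  have "E_gamma \<kappa> \<tau> (p + h *\<^sub>R axis 3 1) = E_gamma \<kappa> \<tau> p" for h
    by (simp add: fun_eq_iff E_gamma_def E_sigma_def axis_def)
  then show ?thesis by (simp add: pderiv_dir_def)
qed

text \<open>The third row of the metric lists the coefficients of \<open>E_form\<close>. Thus
  horizontal unit vectors have Ricci curvature \<kappa> - 2 \<tau>^2 and the vertical one has 2
  \<tau>^2.\<close>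

lemma ricci_E_metric:
  assumes "p \<in> E_chart \<kappa>"
  shows "ricci (E_metric \<kappa> \<tau>) p j k = (\<kappa> - 2 * \<tau>\<^sup>2) * E_metric \<kappa> \<tau> p $ j $ k
    + (4 * \<tau>\<^sup>2 - \<kappa>) * (E_metric \<kappa> \<tau> p $ 3 $ j * E_metric \<kappa> \<tau> p $ 3 $ k)"
proof -
  define S x y where S: "S = E_sigma \<kappa> p" and x: "x = p$1" and y: "y = p$2"
  have rel: "S * (4 + \<kappa> * (x\<^sup>2 + y\<^sup>2)) = 4"
    using E_sigma_relation[OF assms] by (simp_all add: S x y)
  define a where "a = \<kappa> * S"
  have ax: "a * (x * x) = 4 - 4 * S - a * (y * y)"
    using rel by (simp add: a_def field_simps power2_eq_square)
  have axz: "a * (x * (x * z)) = (4 - 4 * S) * z - a * (y * (y * z))" for z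
    using arg_cong[OF ax, of "\<lambda>c. c * z"] by (simp add: algebra_simps)
  have dS: "pderiv_dir v (E_sigma \<kappa>) p = - (a * S) / 2 * (x * v$1 + y * v$2)" for v
    using assms by (simp add: pderiv_dir_E_sigma a_def S x y power2_eq_square)
  have aS: "\<kappa> * S = a" "\<kappa> * (S * z) = a * z" for z
    by (simp_all add: a_def)
  \<comment> \<open>This matrix is the claimed tensor expanded, with a S in place of \<kappa> S^2 to
    match the variables in which \<open>ax\<close> and \<open>axz\<close> rewrite.\<close>
  have "\<forall>j k. ricci (E_metric \<kappa> \<tau>) p j k =
    (vector [
       vector [a * S - 2 * \<tau>^2 * S^2 + 2 * \<tau>^2 * (\<tau> * S * y)^2,
         - 2 * \<tau>^2 * (\<tau> * S * y) * (\<tau> * S * x), 2 * \<tau>^2 * (\<tau> * S * y)],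
       vector [- 2 * \<tau>^2 * (\<tau> * S * y) * (\<tau> * S * x),
         a * S - 2 * \<tau>^2 * S^2 + 2 * \<tau>^2 * (\<tau> * S * x)^2, - 2 * \<tau>^2 * (\<tau> * S * x)],
       vector [2 * \<tau>^2 * (\<tau> * S * y), - 2 * \<tau>^2 * (\<tau> * S * x), 2 * \<tau>^2]] :: real^3^3) $ j $ k"
    unfolding forall_3 ricci_def sum_3 pderiv_dir_christoffel_E_metric[OF assms]
      christoffel_E_metric[OF assms] pd_3_E_gamma
    by (intro conjI; simp add: Let_def E_gamma_def dS E_deriv_simps assms axis_def aS flip: S x y)
       (simp_all add: field_simps power2_eq_square, simp_all add: ax axz ring_distribs mult_ac,
        simp_all add: a_def algebra_simps)
  then show ?thesis
    unfolding E_metric_eq Let_def S[symmetric] x[symmetric] y[symmetric]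
    using exhaust_3[of j] exhaust_3[of k] by (auto simp: a_def algebra_simps power2_eq_square)
qed

lemma ricci_curvature_E_metric:
  assumes "p \<in> E_chart \<kappa>"
  shows "ricci_curvature (E_metric \<kappa> \<tau>) p v = (\<kappa> - 2 * \<tau>\<^sup>2) * metric_at (E_metric \<kappa> \<tau>) p v v
    + (4 * \<tau>\<^sup>2 - \<kappa>) * (E_form \<kappa> \<tau> p v)\<^sup>2"
proof -
  have "E_form \<kappa> \<tau> p v = (\<Sum>j\<in>UNIV. E_metric \<kappa> \<tau> p $ 3 $ j * v $ j)"
    by (simp add: E_form_def E_metric_eq Let_def sum_3 algebra_simps)
  then show ?thesis
    unfolding ricci_curvature_def ricci_E_metric[OF assms] metric_at_def matrix_vector_mult_def inner_vec_def sum_3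
    by (simp add: algebra_simps power2_eq_square)
qed

lemma metric_at_E_metric:
  "metric_at (E_metric \<kappa> \<tau>) p v w
    = (E_sigma \<kappa> p)\<^sup>2 * (v$1 * w$1 + v$2 * w$2) + E_form \<kappa> \<tau> p v * E_form \<kappa> \<tau> p w"
  by (simp add: metric_at_def E_metric_eq Let_def E_form_def matrix_vector_mult_def inner_vec_def sum_3
      algebra_simps power2_eq_square)

section \<open>Geometry of the cylinder\<close>

lemma has_vector_derivative_vector_3:
  assumes "(f has_real_derivative f') (at x)" "(g has_real_derivative g') (at x)"
    "(h has_real_derivative h') (at x)"
  shows "((\<lambda>x. vector [f x, g x, h x] :: real^3) has_vector_derivative vector [f', g', h']) (at x)"
proof -
  have v: "(vector [a, b, c] :: real^3) = a *\<^sub>R axis 1 1 + b *\<^sub>R axis 2 1 + c *\<^sub>R axis 3 1" for a b c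
    by (simp add: vec_eq_iff forall_3 axis_def)
  show ?thesis
    unfolding v using assms
    by (auto intro!: derivative_eq_intros simp: has_real_derivative_iff_has_vector_derivative)
qed

lemma pds_1_snd: "pds 1 (\<lambda>q. f (snd q)) q = 0"
  by (simp add: pderiv_dir_def param_dir_def)

lemma
  assumes "(f has_vector_derivative f') (at x)"
  shows pds_1_fst: "fst q = x \<Longrightarrow> pds 1 (\<lambda>q. f (fst q)) q = f'"
    and pds_2_snd: "snd q = x \<Longrightarrow> pds 2 (\<lambda>q. f (snd q)) q = f'"
proof -
  have "((\<lambda>h. x + h) has_vector_derivative 1) (at 0)"
    by (auto intro!: derivative_eq_intros)
  from vector_diff_chain_at[OF this, of f f'] assms
  have "((\<lambda>h. f (x + h)) has_vector_derivative f') (at 0)"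
    by (simp add: o_def)
  then show "fst q = x \<Longrightarrow> pds 1 (\<lambda>q. f (fst q)) q = f'" "snd q = x \<Longrightarrow> pds 2 (\<lambda>q. f (snd q)) q = f'"
    by (auto simp add: pderiv_dir_def param_dir_def vector_derivative_at)
qed

lemma pds_2_fst: "pds 2 (\<lambda>q. f (fst q)) q = 0"
  by (simp add: pderiv_dir_def param_dir_def)

lemma cyl_param_nth [simp]:
  "cyl_param \<kappa> r q $ 1 = r * cos (fst q / cyl_R \<kappa> r)"
  "cyl_param \<kappa> r q $ 2 = r * sin (fst q / cyl_R \<kappa> r)"
  "cyl_param \<kappa> r q $ 3 = snd q"
  by (simp_all add: cyl_param_def case_prod_beta)

lemma cyl_param_norm: "(cyl_param \<kappa> r q $ 1)\<^sup>2 + (cyl_param \<kappa> r q $ 2)\<^sup>2 = r\<^sup>2"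
  by (simp add: cos_squared_eq algebra_simps)

lemma pds_2_cyl_param: "pds 2 (cyl_param \<kappa> r) = (\<lambda>q. vector [0, 0, 1])"
proof
  fix q
  have "((\<lambda>h. cyl_param \<kappa> r (q + h *\<^sub>R (0, 1))) has_vector_derivative vector [0, 0, 1]) (at 0)"
    unfolding cyl_param_def case_prod_beta
    by (intro has_vector_derivative_vector_3) (auto intro!: derivative_eq_intros)
  then show "pds 2 (cyl_param \<kappa> r) q = vector [0, 0, 1]"
    by (simp add: pderiv_dir_def param_dir_def vector_derivative_at)
qed

context
  fixes \<kappa> r :: real
  assumes r: "0 < r" "\<kappa> < 0 \<longrightarrow> r < 2 / sqrt (-\<kappa>)"
begin

lemma cyl_R_pos: "0 < cyl_R \<kappa> r"
  using cyl_denom_pos[OF r] r(1) by (simp add: cyl_R_def)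

lemma E_sigma_cyl_param: "E_sigma \<kappa> (cyl_param \<kappa> r q) = cyl_R \<kappa> r / r"
  unfolding E_sigma_def cyl_param_norm using r(1) by (simp add: cyl_R_def)

lemma cyl_param_in_E_chart: "cyl_param \<kappa> r q \<in> E_chart \<kappa>"
  unfolding E_chart_def mem_Collect_eq cyl_param_norm using cyl_denom_pos[OF r] by simp

lemma pds_1_cyl_param:
  "pds 1 (cyl_param \<kappa> r) = (\<lambda>q. vector [- (r / cyl_R \<kappa> r) * sin (fst q / cyl_R \<kappa> r),
     r / cyl_R \<kappa> r * cos (fst q / cyl_R \<kappa> r), 0])"
proof
  fix q
  have "((\<lambda>h. cyl_param \<kappa> r (q + h *\<^sub>R (1, 0))) has_vector_derivative
    vector [- (r / cyl_R \<kappa> r) * sin (fst q / cyl_R \<kappa> r), r / cyl_R \<kappa> r * cos (fst q / cyl_R \<kappa> r), 0]) (at 0)"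
    unfolding cyl_param_def case_prod_beta using cyl_R_pos
    by (intro has_vector_derivative_vector_3) (auto intro!: derivative_eq_intros)
  then show "pds 1 (cyl_param \<kappa> r) q = vector [- (r / cyl_R \<kappa> r) * sin (fst q / cyl_R \<kappa> r),
     r / cyl_R \<kappa> r * cos (fst q / cyl_R \<kappa> r), 0]"
    by (simp add: pderiv_dir_def param_dir_def vector_derivative_at)
qed

lemma pds_pds_cyl_param:
  "pds a (pds b (cyl_param \<kappa> r)) q = (if a = 1 \<and> b = 1 then
     vector [- (r / (cyl_R \<kappa> r)\<^sup>2) * cos (fst q / cyl_R \<kappa> r), - (r / (cyl_R \<kappa> r)\<^sup>2) * sin (fst q / cyl_R \<kappa> r), 0]
     else 0)"
proof -
  have "((\<lambda>s. vector [- (r / cyl_R \<kappa> r) * sin (s / cyl_R \<kappa> r), r / cyl_R \<kappa> r * cos (s / cyl_R \<kappa> r), 0] :: real^3)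
     has_vector_derivative vector [- (r / (cyl_R \<kappa> r)\<^sup>2) * cos (s / cyl_R \<kappa> r), - (r / (cyl_R \<kappa> r)\<^sup>2) * sin (s / cyl_R \<kappa> r), 0])
     (at s)" for s
    using cyl_R_pos
    by (intro has_vector_derivative_vector_3)
       (auto intro!: derivative_eq_intros simp: power2_eq_square)
  from pds_1_fst[OF this refl] have "pds 1 (pds 1 (cyl_param \<kappa> r)) q =
      vector [- (r / (cyl_R \<kappa> r)\<^sup>2) * cos (fst q / cyl_R \<kappa> r), - (r / (cyl_R \<kappa> r)\<^sup>2) * sin (fst q / cyl_R \<kappa> r), 0]"
    unfolding pds_1_cyl_param by simp
  moreover have "pds 2 (pds 1 (cyl_param \<kappa> r)) q = 0"
    unfolding pds_1_cyl_param by (rule pds_2_fst)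
  ultimately show ?thesis
    using exhaust_2[of a] exhaust_2[of b] by (auto simp: pds_2_cyl_param pderiv_dir_const)
qed

section \<open>First form, unit normal and second form of the cylinder\<close>

lemma first_form_cyl:
  "first_form (E_metric \<kappa> \<tau>) (cyl_param \<kappa> r) q
    = vector [vector [1 + \<tau>\<^sup>2 * r\<^sup>2, - (\<tau> * r)], vector [- (\<tau> * r), 1]]"
proof -
  have *: "(sin x)\<^sup>2 = 1 - (cos x)\<^sup>2" for x :: real by (simp add: sin_squared_eq)
  \<comment> \<open>The vertical component of the s-direction. Adding \<tau> r times the t-direction
    therefore gives the horizontal unit tangent.\<close>
  have "E_form \<kappa> \<tau> (cyl_param \<kappa> r q) (pds 1 (cyl_param \<kappa> r) q) = - (\<tau> * r)"
    using r(1) cyl_R_pos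
    by (simp add: E_form_def E_sigma_cyl_param pds_1_cyl_param field_simps power2_eq_square[symmetric] *)
  moreover have "E_form \<kappa> \<tau> (cyl_param \<kappa> r q) (pds 2 (cyl_param \<kappa> r) q) = 1"
    by (simp add: E_form_def pds_2_cyl_param)
  ultimately show ?thesis
    using r(1) cyl_R_pos
    by (simp add: vec_eq_iff forall_2 first_form_def metric_at_E_metric E_sigma_cyl_param)
       (simp add: pds_1_cyl_param pds_2_cyl_param field_simps power2_eq_square[symmetric] *)
qed

lemma area_density_cyl: "area_density (E_metric \<kappa> \<tau>) (cyl_param \<kappa> r) q = 1"
  by (simp add: area_density_def first_form_cyl det_2 power2_eq_square)

lemma matrix_inv_first_form_cyl:
  "matrix_inv (first_form (E_metric \<kappa> \<tau>) (cyl_param \<kappa> r) q)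
    = vector [vector [1, \<tau> * r], vector [\<tau> * r, 1 + \<tau>\<^sup>2 * r\<^sup>2]]"
  by (rule matrix_inv_eqI)
     (simp_all add: first_form_cyl vec_eq_iff forall_2 matrix_matrix_mult_def sum_2 mat_def
       power2_eq_square algebra_simps)

text \<open>Orthogonality to the t-direction makes N horizontal, and orthogonality to the
  s-direction then makes it radial. Length 1 fixes c only up to sign; this suffices because the
  potential is quadratic in N.\<close>

lemma unit_normal_cyl:
  assumes N: "unit_normal (E_metric \<kappa> \<tau>) (cyl_param \<kappa> r) D N" and q: "q \<in> D"
  obtains c where "c\<^sup>2 = (r / cyl_R \<kappa> r)\<^sup>2" "N q $ 1 = c * cos (fst q / cyl_R \<kappa> r)"
    "N q $ 2 = c * sin (fst q / cyl_R \<kappa> r)" "E_form \<kappa> \<tau> (cyl_param \<kappa> r q) (N q) = 0"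
proof -
  define R C S where R: "R = cyl_R \<kappa> r" and C: "C = cos (fst q / cyl_R \<kappa> r)"
    and S: "S = sin (fst q / cyl_R \<kappa> r)"
  have Rr: "R > 0" "r \<noteq> 0" using cyl_R_pos r(1) by (simp_all add: R)
  have SC: "S * S = 1 - C * C" using sin_cos_squared_add[of "fst q / cyl_R \<kappa> r"]
    by (simp add: S C power2_eq_square)
  have N1: "metric_at (E_metric \<kappa> \<tau>) (cyl_param \<kappa> r q) (N q) (N q) = 1"
    and N2: "metric_at (E_metric \<kappa> \<tau>) (cyl_param \<kappa> r q) (N q) (pds a (cyl_param \<kappa> r) q) = 0" for a
    using N q by (auto simp: unit_normal_def)
  have w: "E_form \<kappa> \<tau> (cyl_param \<kappa> r q) (N q) = 0"
    using N2[of 2] by (simp add: metric_at_E_metric pds_2_cyl_param E_form_def)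
  have "(R / r)\<^sup>2 * (r / R) * (N q $ 2 * C - N q $ 1 * S) = 0"
    using N2[of 1] unfolding metric_at_E_metric w E_sigma_cyl_param pds_1_cyl_param
    by (simp add: R C S algebra_simps)
  then have t: "N q $ 2 * C = N q $ 1 * S"
    using Rr by simp
  define c where "c = N q $ 1 * C + N q $ 2 * S"
  have n1: "N q $ 1 = c * C"
  proof -
    have "c * C = N q $ 1 * (C * C) + (N q $ 2 * C) * S" by (simp add: c_def algebra_simps)
    also have "\<dots> = N q $ 1 * (C * C) + N q $ 1 * (S * S)" by (simp add: t)
    finally show ?thesis by (simp add: SC algebra_simps)
  qed
  have n2: "N q $ 2 = c * S"
  proof -
    have "c * S = (N q $ 1 * S) * C + N q $ 2 * (S * S)" by (simp add: c_def algebra_simps)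
    also have "\<dots> = N q $ 2 * (C * C) + N q $ 2 * (S * S)" by (simp add: t[symmetric])
    finally show ?thesis by (simp add: SC algebra_simps)
  qed
  have "(R / r)\<^sup>2 * (c * c * (C * C + S * S)) = 1"
    using N1 unfolding metric_at_E_metric w E_sigma_cyl_param n1 n2
    by (simp add: R algebra_simps)
  then have "c\<^sup>2 = (r / R)\<^sup>2"
    using Rr by (simp add: SC power2_eq_square field_simps)
  then show ?thesis
    using that n1 n2 w by (simp add: R C S)
qed

text \<open>For a unit normal d is 1 or -1, and 1/R - \<kappa> r/2 = (4 - \<kappa> r^2)/(4 r) is the
  geodesic curvature of the circle. The extra 2 \<tau>^2 r comes from the vertical component of the
  s-direction: it cancels against the mixed term on the horizontal tangent.\<close>

lemma second_form_cyl:
  assumes c: "N q $ 1 = c * cos (fst q / cyl_R \<kappa> r)" "N q $ 2 = c * sin (fst q / cyl_R \<kappa> r)"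
    "E_form \<kappa> \<tau> (cyl_param \<kappa> r q) (N q) = 0"
  shows "second_form (E_metric \<kappa> \<tau>) (cyl_param \<kappa> r) N q = (let d = c * (cyl_R \<kappa> r / r) in
    vector [vector [- (d * (1 / cyl_R \<kappa> r - \<kappa> * r / 2 + 2 * \<tau>\<^sup>2 * r)), d * \<tau>], vector [d * \<tau>, 0]])"
proof -
  define R C S where R: "R = cyl_R \<kappa> r" and C: "C = cos (fst q / R)"
    and S: "S = sin (fst q / R)"
  have Rr: "R > 0" "r \<noteq> 0" using cyl_R_pos r(1) by (simp_all add: R)
  have SC: "S * S = 1 - C * C" using sin_cos_squared_add[of "fst q / R"]
    by (simp add: S C power2_eq_square)
  have SCz: "S * (S * z) = z - C * (C * z)" for z
    using arg_cong[OF SC, of "\<lambda>c. c * z"] by (simp add: algebra_simps)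
  \<comment> \<open>N is horizontal and radial, so pairing with it sees only the radial part of the
    first two coordinates.\<close>
  have h: "second_form (E_metric \<kappa> \<tau>) (cyl_param \<kappa> r) N q $ a $ b = (R / r)\<^sup>2 * c *
     (cov_deriv2 (E_metric \<kappa> \<tau>) (cyl_param \<kappa> r) a b q $ 1 * C
     + cov_deriv2 (E_metric \<kappa> \<tau>) (cyl_param \<kappa> r) a b q $ 2 * S)" for a b
    by (simp add: second_form_def metric_at_E_metric c E_sigma_cyl_param algebra_simps flip: R C S)
  show ?thesis
    unfolding vec_eq_iff forall_2 h cov_deriv2_def pds_pds_cyl_param
    by (intro conjI; simp add: sum_3 christoffel_E_metric[OF cyl_param_in_E_chart] pds_1_cyl_param
          pds_2_cyl_param E_gamma_def Let_def E_sigma_cyl_param flip: R C S)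
       (simp_all add: Rr field_simps power2_eq_square, simp_all add: SC SCz ring_distribs mult_ac)
qed

lemma cyl_potential:
  assumes N: "unit_normal (E_metric \<kappa> \<tau>) (cyl_param \<kappa> r) D N" and q: "q \<in> D"
  shows "second_form_norm_sq (E_metric \<kappa> \<tau>) (cyl_param \<kappa> r) N q
    + ricci_curvature (E_metric \<kappa> \<tau>) (cyl_param \<kappa> r q) (N q) = 1 / (cyl_R \<kappa> r)\<^sup>2"
proof -
  obtain c where c: "c\<^sup>2 = (r / cyl_R \<kappa> r)\<^sup>2" "N q $ 1 = c * cos (fst q / cyl_R \<kappa> r)"
    "N q $ 2 = c * sin (fst q / cyl_R \<kappa> r)" "E_form \<kappa> \<tau> (cyl_param \<kappa> r q) (N q) = 0"
    using unit_normal_cyl[OF N q] .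
  define d k where "d = c * (cyl_R \<kappa> r / r)" and "k = 1 / cyl_R \<kappa> r - \<kappa> * r / 2"
  have d: "d * d = 1"
    using c(1) r(1) cyl_R_pos by (simp add: d_def power2_eq_square field_simps)
  then have dz: "d * (d * z) = z" for z by (simp flip: mult.assoc)
  have "second_form_norm_sq (E_metric \<kappa> \<tau>) (cyl_param \<kappa> r) N q = k\<^sup>2 + 2 * \<tau>\<^sup>2"
    unfolding second_form_norm_sq_def matrix_inv_first_form_cyl
      second_form_cyl[where N = N and q = q, OF c(2-4)] Let_def sum_2 d_def[symmetric] k_def[symmetric]
    by (simp add: power2_eq_square) (simp add: d dz algebra_simps)
  moreover have "ricci_curvature (E_metric \<kappa> \<tau>) (cyl_param \<kappa> r q) (N q) = \<kappa> - 2 * \<tau>\<^sup>2"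
    using N q unfolding ricci_curvature_E_metric[OF cyl_param_in_E_chart] c(4)
    by (simp add: unit_normal_def)
  \<comment> \<open>Since r/R = 1 + \<kappa> r^2/4, the cross term -\<kappa> r/R of k^2 cancels
    \<kappa> + \<kappa>^2 r^2/4.\<close>
  moreover have "k\<^sup>2 + \<kappa> = 1 / (cyl_R \<kappa> r)\<^sup>2"
    using r(1) cyl_denom_pos[OF r] by (simp add: k_def cyl_R_def field_simps power2_eq_square)
  ultimately show ?thesis by simp
qed

section \<open>The Jacobi operator and the index form on functions of t\<close>

lemma jacobi_operator_axial:
  assumes N: "unit_normal (E_metric \<kappa> \<tau>) (cyl_param \<kappa> r) (cyl_domain \<kappa> r L) N"
    and q: "(s, t) \<in> cyl_domain \<kappa> r L" "0 < t" "t < L"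
    and u: "\<And>t. 0 < t \<Longrightarrow> t < L \<Longrightarrow> (u has_real_derivative u' t) (at t)"
      "\<And>t. 0 < t \<Longrightarrow> t < L \<Longrightarrow> (u' has_real_derivative u'' t) (at t)"
  shows "jacobi_operator (E_metric \<kappa> \<tau>) (cyl_param \<kappa> r) N (\<lambda>(s, t). u t) (s, t)
    = (1 + \<tau>\<^sup>2 * r\<^sup>2) * u'' t + u t / (cyl_R \<kappa> r)\<^sup>2"
proof -
  \<comment> \<open>The outer derivative of the Laplacian needs the inner one on a neighbourhood.
    The strip is unbounded in s so that it is also open around points with s on the boundary of the
    domain.\<close>
  let ?S = "UNIV \<times> {0<..<L} :: (real \<times> real) set"
  have S: "open ?S" "(s, t) \<in> ?S" using q by (auto intro: open_Times)
  have eq: "(\<lambda>(s, t). u t) = (\<lambda>q. u (snd q))" by auto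
  have d1: "pds 1 (\<lambda>(s, t). u t) q = 0" for q
    unfolding eq by (rule pds_1_snd)
  have d2: "pds 2 (\<lambda>(s, t). u t) q = u' (snd q)" if "q \<in> ?S" for q
    using pds_2_snd[of u "u' (snd q)" "snd q" q] u(1)[of "snd q"] that
    by (simp add: eq has_real_derivative_iff_has_vector_derivative mem_Times_iff)
  have "pds a (\<lambda>q. \<Sum>b\<in>UNIV. area_density (E_metric \<kappa> \<tau>) (cyl_param \<kappa> r) q *
        matrix_inv (first_form (E_metric \<kappa> \<tau>) (cyl_param \<kappa> r) q) $ a $ b * pds b (\<lambda>(s, t). u t) q) (s, t)
      = pds a (\<lambda>q. (vector [\<tau> * r, 1 + \<tau>\<^sup>2 * r\<^sup>2] :: real^2) $ a * u' (snd q)) (s, t)" for a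
    using exhaust_2[of a]
    by (intro pderiv_dir_cong_open[OF S])
       (auto simp: area_density_cyl matrix_inv_first_form_cyl sum_2 d1 d2)
  moreover have "pds 2 (\<lambda>q. (1 + \<tau>\<^sup>2 * r\<^sup>2) * u' (snd q)) (s, t) = (1 + \<tau>\<^sup>2 * r\<^sup>2) * u'' t"
    by (rule pds_2_snd[where x = t])
       (use u(2)[OF q(2,3)] in \<open>auto simp flip: has_real_derivative_iff_has_vector_derivative
          intro!: derivative_eq_intros\<close>)
  moreover have "pds 1 (\<lambda>q. \<tau> * r * u' (snd q)) (s, t) = 0" by (rule pds_1_snd)
  ultimately have "surface_laplacian (E_metric \<kappa> \<tau>) (cyl_param \<kappa> r) (\<lambda>(s, t). u t) (s, t)
      = (1 + \<tau>\<^sup>2 * r\<^sup>2) * u'' t"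
    by (simp add: surface_laplacian_def sum_2 area_density_cyl)
  then show ?thesis
    using cyl_potential[OF N q(1)] unfolding jacobi_operator_def
    by (simp flip: distrib_right add: add.assoc)
qed

lemma surface_integral_axial:
  assumes f: "continuous_on {0..L} f"
    and g: "\<And>s t. (s, t) \<in> cyl_domain \<kappa> r L \<Longrightarrow> 0 < t \<Longrightarrow> t < L \<Longrightarrow> g (s, t) = f t"
  shows "surface_integral (E_metric \<kappa> \<tau>) (cyl_param \<kappa> r) (cyl_domain \<kappa> r L) g
    = 2 * pi * cyl_R \<kappa> r * integral {0..L} f"
proof -
  have D: "cyl_domain \<kappa> r L = cbox (0, 0) (2 * pi * cyl_R \<kappa> r, L)"
    by (simp add: cyl_domain_def cbox_Pair_eq)
  \<comment> \<open>The edges t = 0 and t = L, where \<open>g\<close> is not controlled, lie in two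
    hyperplanes of measure zero.\<close>
  let ?E = "{q :: real \<times> real. q \<bullet> (0, 1) = 0} \<union> {q. q \<bullet> (0, 1) = L}"
  have "((0, 1) :: real \<times> real) \<in> Basis" by (simp add: Basis_prod_def)
  then have "negligible ?E" by (intro negligible_Un negligible_standard_hyperplane)
  moreover have "f (snd q) = g q" if "q \<in> cyl_domain \<kappa> r L - ?E" for q
    using that g[of "fst q" "snd q"] by (cases q) (auto simp: cyl_domain_def)
  ultimately have "integral (cyl_domain \<kappa> r L) g = integral (cyl_domain \<kappa> r L) (\<lambda>q. f (snd q))"
    by (rule integral_spike[symmetric, OF _ sym])
  also have "\<dots> = integral (cbox 0 (2 * pi * cyl_R \<kappa> r)) (\<lambda>s. integral (cbox 0 L) f)"
    unfolding D
    by (subst integral_prod_continuous)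
       (auto intro!: continuous_on_compose2[OF f] continuous_intros simp: cbox_Pair_eq)
  also have "\<dots> = 2 * pi * cyl_R \<kappa> r * integral {0..L} f"
    using cyl_R_pos by simp
  finally show ?thesis by (simp add: surface_integral_def area_density_cyl)
qed

text \<open>The sequence \<open>D\<close> stands for the derivatives of \<open>u\<close>: it is
  continuous up to the endpoints, although \<open>u\<close> need not have two-sided derivatives
  there. In the open interval the derivatives in \<open>D\<close> are two-sided, as the Jacobi
  operator requires.\<close>

lemma index_form_axial:
  assumes N: "unit_normal (E_metric \<kappa> \<tau>) (cyl_param \<kappa> r) (cyl_domain \<kappa> r L) N"
    and D0: "\<And>t. t \<in> {0..L} \<Longrightarrow> D 0 t = u t"
    and D: "\<And>n t. t \<in> {0..L} \<Longrightarrow> (D n has_real_derivative D (Suc n) t) (at t within {0..L})"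
  shows "index_form (E_metric \<kappa> \<tau>) (cyl_param \<kappa> r) (cyl_domain \<kappa> r L) N (\<lambda>(s, t). u t)
    = - (2 * pi * cyl_R \<kappa> r) * integral {0..L}
        (\<lambda>t. D 0 t * ((1 + \<tau>\<^sup>2 * r\<^sup>2) * D 2 t + D 0 t / (cyl_R \<kappa> r)\<^sup>2))"
proof -
  have cont: "continuous_on {0..L} (D n)" for n
    using D by (intro DERIV_continuous_on)
  have at: "(D n has_real_derivative D (Suc n) t) (at t)" if "0 < t" "t < L" for n t
    using D[of t n] that at_within_interior[of t "{0..L}"] by simp
  have u: "(u has_real_derivative D 1 t) (at t)" if "0 < t" "t < L" for t
  proof -
    have "\<forall>\<^sub>F x in nhds t. x \<in> {0<..<L}"
      using that by (intro eventually_nhds_in_open) auto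
    then have "\<forall>\<^sub>F x in nhds t. u x = D 0 x"
      by eventually_elim (simp add: D0)
    then show ?thesis
      using at[OF that, of 0] by (simp add: DERIV_cong_ev)
  qed
  show ?thesis
    unfolding index_form_def
  proof (subst surface_integral_axial)
    show "continuous_on {0..L} (\<lambda>t. D 0 t * ((1 + \<tau>\<^sup>2 * r\<^sup>2) * D 2 t + D 0 t / (cyl_R \<kappa> r)\<^sup>2))"
      using cyl_R_pos by (intro continuous_intros cont) auto
    show "(case (s, t) of (s, t) \<Rightarrow> u t) * jacobi_operator (E_metric \<kappa> \<tau>) (cyl_param \<kappa> r) N (\<lambda>(s, t). u t) (s, t)
      = D 0 t * ((1 + \<tau>\<^sup>2 * r\<^sup>2) * D 2 t + D 0 t / (cyl_R \<kappa> r)\<^sup>2)"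
      if "(s, t) \<in> cyl_domain \<kappa> r L" "0 < t" "t < L" for s t
      using jacobi_operator_axial[OF N that u, of "D 2"] at[of _ 1] that D0[of t]
      by (simp add: numeral_2_eq_2)
  qed auto
qed

end

section \<open>Wirtinger inequalities\<close>

text \<open>The weight \<open>w = - k tan (k (t - m))\<close> solves \<open>w' + w\<^sup>2 + k\<^sup>2 = 0\<close>, so
  \<open>f'\<^sup>2 - k\<^sup>2 f\<^sup>2 - (w f\<^sup>2)' = (f' - w f)\<^sup>2 \<ge> 0\<close>.\<close>

lemma wirtinger_tan_weight:
  fixes f f' :: "real \<Rightarrow> real"
  assumes pq: "p \<le> q" and w: "\<And>t. t \<in> {p..q} \<Longrightarrow> \<bar>k * (t - m)\<bar> < pi / 2"
    and f: "\<And>t. t \<in> {p..q} \<Longrightarrow> (f has_real_derivative f' t) (at t within {p..q})"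
    and f': "continuous_on {p..q} f'"
  shows "k * tan (k * (p - m)) * (f p)\<^sup>2 - k * tan (k * (q - m)) * (f q)\<^sup>2
    \<le> integral {p..q} (\<lambda>t. (f' t)\<^sup>2 - k\<^sup>2 * (f t)\<^sup>2)"
proof -
  define F where "F t = - k * tan (k * (t - m)) * (f t)\<^sup>2" for t
  define F' where "F' t = - (k\<^sup>2 * (1 + (tan (k * (t - m)))\<^sup>2) * (f t)\<^sup>2
    + 2 * k * tan (k * (t - m)) * f t * f' t)" for t
  have "(F has_real_derivative F' t) (at t within {p..q})" if t: "t \<in> {p..q}" for t
  proof -
    have c: "cos (k * (t - m)) \<noteq> 0"
    proof -
      have "- (pi / 2) < k * (t - m)" "k * (t - m) < pi / 2" using w[OF t] by linarith+
      then show ?thesis using cos_gt_zero_pi by fastforce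
    qed
    have "1 + (tan (k * (t - m)))\<^sup>2 = inverse ((cos (k * (t - m)))\<^sup>2)"
      using tan_sec[OF c] by (simp add: power_inverse)
    then show ?thesis
      unfolding F_def[abs_def] F'_def using c
      by (auto intro!: derivative_eq_intros f[OF t] c simp: power2_eq_square algebra_simps)
  qed
  then have "(F' has_integral F q - F p) {p..q}"
    by (intro fundamental_theorem_of_calculus pq)
       (auto simp flip: has_real_derivative_iff_has_vector_derivative)
  moreover have "continuous_on {p..q} f" using f by (rule DERIV_continuous_on)
  then have "(\<lambda>t. (f' t)\<^sup>2 - k\<^sup>2 * (f t)\<^sup>2) integrable_on {p..q}"
    by (intro integrable_continuous_interval continuous_intros f')
  then have "((\<lambda>t. (f' t)\<^sup>2 - k\<^sup>2 * (f t)\<^sup>2) has_integral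
      integral {p..q} (\<lambda>t. (f' t)\<^sup>2 - k\<^sup>2 * (f t)\<^sup>2)) {p..q}"
    by (rule integrable_integral)
  ultimately have "F q - F p \<le> integral {p..q} (\<lambda>t. (f' t)\<^sup>2 - k\<^sup>2 * (f t)\<^sup>2)"
  proof (rule has_integral_le)
    fix t
    have "0 \<le> (f' t + k * tan (k * (t - m)) * f t)\<^sup>2" by simp
    then show "F' t \<le> (f' t)\<^sup>2 - k\<^sup>2 * (f t)\<^sup>2"
      by (simp add: F'_def power2_eq_square algebra_simps)
  qed
  then show ?thesis by (simp add: F_def)
qed

text \<open>This reaches the sharp constant K^2 from the constants k^2 with k < K, for which the
  tangent weight is finite on the closed interval.\<close>

lemma power2_mult_le_left_limit:
  fixes A B K :: real
  assumes "0 < K" "\<And>k. 0 < k \<Longrightarrow> k < K \<Longrightarrow> k\<^sup>2 * A \<le> B"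
  shows "K\<^sup>2 * A \<le> B"
proof (rule tendsto_upperbound)
  show "((\<lambda>k. k\<^sup>2 * A) \<longlongrightarrow> K\<^sup>2 * A) (at_left K)" by (intro tendsto_intros)
  show "\<forall>\<^sub>F k in at_left K. k\<^sup>2 * A \<le> B"
    using eventually_at_left_real[OF assms(1)] by eventually_elim (use assms(2) in auto)
qed simp

context
  fixes u u' :: "real \<Rightarrow> real" and L :: real
  assumes L: "0 < L"
    and u: "\<And>t. t \<in> {0..L} \<Longrightarrow> (u has_real_derivative u' t) (at t within {0..L})"
    and u': "continuous_on {0..L} u'"
begin

private lemma cont_u: "continuous_on {0..L} u"
  using u by (rule DERIV_continuous_on)

text \<open>Centre the tangent weight at the midpoint: k L/2 < pi/2 keeps it finite on the whole
  interval, and both boundary terms contain a vanishing value of \<open>u\<close>.\<close>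

lemma wirtinger_dirichlet:
  assumes "u 0 = 0" "u L = 0"
  shows "(pi / L)\<^sup>2 * integral {0..L} (\<lambda>t. (u t)\<^sup>2) \<le> integral {0..L} (\<lambda>t. (u' t)\<^sup>2)"
proof (rule power2_mult_le_left_limit)
  fix k assume k: "0 < k" "k < pi / L"
  have "\<bar>k * (t - L / 2)\<bar> < pi / 2" if "t \<in> {0..L}" for t
  proof -
    have "\<bar>t - L / 2\<bar> \<le> L / 2" by (intro abs_leI) (use that in auto)
    then have "k * \<bar>t - L / 2\<bar> \<le> k * (L / 2)"
      using k by (intro mult_left_mono) auto
    also have "\<dots> < pi / 2" using k L by (simp add: field_simps)
    finally show ?thesis using k by (simp add: abs_mult)
  qed
  from wirtinger_tan_weight[OF _ this u u'] assms L
  have "0 \<le> integral {0..L} (\<lambda>t. (u' t)\<^sup>2 - k\<^sup>2 * (u t)\<^sup>2)" by simp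
  also have "\<dots> = integral {0..L} (\<lambda>t. (u' t)\<^sup>2) - k\<^sup>2 * integral {0..L} (\<lambda>t. (u t)\<^sup>2)"
    by (subst integral_diff)
       (auto intro!: integrable_continuous_interval continuous_intros u' cont_u)
  finally show "k\<^sup>2 * integral {0..L} (\<lambda>t. (u t)\<^sup>2) \<le> integral {0..L} (\<lambda>t. (u' t)\<^sup>2)" by simp
qed (use L in simp)

text \<open>Choosing \<open>a\<close> with \<open>u (a + L/2) = u a\<close>, the function \<open>v = u - u a\<close> vanishes at the ends of two
  intervals of length \<open>L/2\<close> on the circle of length \<open>L\<close>. One of them wraps around, and its two boundary
  terms at \<open>0\<close> and \<open>L\<close> cancel by periodicity.\<close>

lemma wirtinger_periodic:
  assumes per: "u 0 = u L" and mean: "integral {0..L} u = 0"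
  shows "(2 * pi / L)\<^sup>2 * integral {0..L} (\<lambda>t. (u t)\<^sup>2) \<le> integral {0..L} (\<lambda>t. (u' t)\<^sup>2)"
proof (rule power2_mult_le_left_limit)
  fix k assume k: "0 < k" "k < 2 * pi / L"
  \<comment> \<open>Periodicity gives g (L/2) = - g 0, so g has a zero on [0, L/2].\<close>
  define g where "g a = u (a + L / 2) - u a" for a
  have cg: "continuous_on {0..L/2} g"
    unfolding g_def using L by (intro continuous_intros continuous_on_compose2[OF cont_u]) auto
  have "g 0 = - g (L / 2)" using per by (simp add: g_def)
  then have "\<exists>a\<ge>0. a \<le> L / 2 \<and> g a = 0"
    using L IVT'[OF _ _ _ cg, of 0] IVT2'[OF _ _ _ cg, of 0] by (cases "g 0 \<le> 0") auto
  then obtain a where a: "0 \<le> a" "a \<le> L / 2" "u (a + L / 2) = u a" by (auto simp: g_def)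
  \<comment> \<open>Subtracting \<open>u a\<close> creates two zeros half a period apart; a weight
    centred between them stays finite since k L/4 < pi/2.\<close>
  define v where "v t = u t - u a" for t
  have v: "(v has_real_derivative u' t) (at t within {p..q})" if "0 \<le> p" "q \<le> L" "t \<in> {p..q}" for p q t
  proof -
    have "(u has_real_derivative u' t) (at t within {p..q})"
      by (rule DERIV_subset[OF u]) (use that in auto)
    then show ?thesis unfolding v_def[abs_def] by (auto intro!: derivative_eq_intros)
  qed
  have cv: "continuous_on {p..q} (\<lambda>t. (u' t)\<^sup>2 - k\<^sup>2 * (v t)\<^sup>2)" if "0 \<le> p" "q \<le> L" for p q
    unfolding v_def
    using that by (intro continuous_intros continuous_on_subset[OF u'] continuous_on_subset[OF cont_u]) auto
  let ?I = "\<lambda>p q. integral {p..q} (\<lambda>t. (u' t)\<^sup>2 - k\<^sup>2 * (v t)\<^sup>2)"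
  have w: "k * tan (k * (p - m)) * (v p)\<^sup>2 - k * tan (k * (q - m)) * (v q)\<^sup>2 \<le> ?I p q"
    if pq: "0 \<le> p" "p \<le> q" "q \<le> L" and m: "m - L / 4 \<le> p" "q \<le> m + L / 4" for p q m
  proof (rule wirtinger_tan_weight[OF pq(2)])
    show "\<bar>k * (t - m)\<bar> < pi / 2" if "t \<in> {p..q}" for t
    proof -
      have "\<bar>t - m\<bar> \<le> L / 4" by (intro abs_leI) (use that m in auto)
      then have "k * \<bar>t - m\<bar> \<le> k * (L / 4)"
        using k by (intro mult_left_mono) auto
      also have "\<dots> < pi / 2" using k L by (simp add: field_simps)
      finally show ?thesis using k by (simp add: abs_mult)
    qed
    show "continuous_on {p..q} u'" using pq by (intro continuous_on_subset[OF u']) auto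
  qed (use v pq in auto)
  have va: "v a = 0" "v (a + L / 2) = 0" and vL: "v L = v 0" using a(3) per by (simp_all add: v_def)
  \<comment> \<open>The centres a - L/4 and a + 3L/4 of the two pieces of the wrapped interval
    differ by L, so the weights at 0 and at L agree.\<close>
  have arg: "k * (0 - (a - L / 4)) = k * (L - (a + 3 * L / 4))" by (simp add: field_simps)
  have "?I 0 a + ?I a (a + L / 2) = ?I 0 (a + L / 2)" "?I 0 (a + L / 2) + ?I (a + L / 2) L = ?I 0 L"
    using a L by (auto intro!: Henstock_Kurzweil_Integration.integral_combine integrable_continuous_interval cv)
  moreover have "k * tan (k * (0 - (a - L / 4))) * (v 0)\<^sup>2 \<le> ?I 0 a"
    using w[of 0 a "a - L / 4"] a L va by simp
  moreover have "0 \<le> ?I a (a + L / 2)"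
    using w[of a "a + L / 2" "a + L / 4"] a L va by simp
  moreover have "- (k * tan (k * (0 - (a - L / 4))) * (v 0)\<^sup>2) \<le> ?I (a + L / 2) L"
    unfolding arg using w[of "a + L / 2" L "a + 3 * L / 4"] a L va vL by simp
  ultimately have "0 \<le> ?I 0 L" by linarith
  \<comment> \<open>Back from v to u: the cross term vanishes by the mean-zero condition, and the
    remaining constant term is at most 0.\<close>
  also have "?I 0 L = integral {0..L} (\<lambda>t. (u' t)\<^sup>2 - k\<^sup>2 * (u t)\<^sup>2 + 2 * k\<^sup>2 * u a * u t - k\<^sup>2 * (u a)\<^sup>2)"
    by (simp add: v_def power2_eq_square algebra_simps)
  also have "\<dots> = integral {0..L} (\<lambda>t. (u' t)\<^sup>2) - k\<^sup>2 * integral {0..L} (\<lambda>t. (u t)\<^sup>2)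
      + 2 * k\<^sup>2 * u a * integral {0..L} u - k\<^sup>2 * (u a)\<^sup>2 * L"
  proof -
    have i: "(\<lambda>t. (u' t)\<^sup>2) integrable_on {0..L}" "(\<lambda>t. (u t)\<^sup>2) integrable_on {0..L}" "u integrable_on {0..L}"
      by (auto intro!: integrable_continuous_interval continuous_intros u' cont_u)
    show ?thesis
      using has_integral_diff[OF has_integral_add[OF has_integral_diff[OF
          integrable_integral[OF i(1)] has_integral_mult_right[OF integrable_integral[OF i(2)], of "k\<^sup>2"]]
          has_integral_mult_right[OF integrable_integral[OF i(3)], of "2 * k\<^sup>2 * u a"]]
          has_integral_const_real[of "k\<^sup>2 * (u a)\<^sup>2" 0 L]] L
      by (intro integral_unique) (simp add: mult.commute)
  qed
  also have "\<dots> \<le> integral {0..L} (\<lambda>t. (u' t)\<^sup>2) - k\<^sup>2 * integral {0..L} (\<lambda>t. (u t)\<^sup>2)"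
    using L mean by simp
  finally show "k\<^sup>2 * integral {0..L} (\<lambda>t. (u t)\<^sup>2) \<le> integral {0..L} (\<lambda>t. (u' t)\<^sup>2)" by simp
qed (use L in simp)

end

section \<open>Stability\<close>

lemma sinh_tanh_half: "sinh (2 * x) = 2 * tanh x / (1 - (tanh x)\<^sup>2)" for x :: real
proof -
  have "1 - (tanh x)\<^sup>2 = ((cosh x)\<^sup>2 - (sinh x)\<^sup>2) / (cosh x)\<^sup>2"
    by (simp add: tanh_def power_divide diff_divide_distrib)
  then have "1 - (tanh x)\<^sup>2 = 1 / (cosh x)\<^sup>2"
    by (simp only: hyperbolic_pythagoras)
  then show ?thesis by (simp add: sinh_double tanh_def power2_eq_square)
qed

lemma tanh_artanh:
  fixes x :: real
  assumes "\<bar>x\<bar> < 1"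
  shows "tanh (artanh x) = x"
  using artanh_real_inj[of "tanh (artanh x)" x] assms artanh_tanh_real tanh_real_bounds
  by (simp add: abs_less_iff)

text \<open>The radius is twice an inverse tangent (hyperbolic for \<kappa> < 0) of r sqrt
  |\<kappa>| / 2, divided by sqrt |\<kappa>|. So the half-angle formulas make \<open>L0\<close>
  algebraic in r: the sine factor yields R, and the root yields sqrt (1 + \<tau>^2 r^2).\<close>

lemma L0_circle_radius:
  assumes r: "0 < r" "\<kappa> < 0 \<longrightarrow> r < 2 / sqrt (-\<kappa>)"
  shows "L0 \<kappa> \<tau> (circle_radius \<kappa> r) = 2 * pi * cyl_R \<kappa> r * sqrt (1 + \<tau>\<^sup>2 * r\<^sup>2)"
proof -
  have root: "sqrt (a * a + 4 * \<tau>\<^sup>2 * (r * a / 2)\<^sup>2) = a * sqrt (1 + \<tau>\<^sup>2 * r\<^sup>2)" if "a \<ge> 0" for a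
  proof -
    have "a * a + 4 * \<tau>\<^sup>2 * (r * a / 2)\<^sup>2 = a\<^sup>2 * (1 + \<tau>\<^sup>2 * r\<^sup>2)"
      by (simp add: power2_eq_square algebra_simps)
    then show ?thesis using that by (simp add: real_sqrt_mult)
  qed
  consider "\<kappa> < 0" | "\<kappa> = 0" | "\<kappa> > 0" by linarith
  then show ?thesis
  proof cases
    case 1
    define a where "a = sqrt (-\<kappa>)"
    have a: "0 < a" and k: "\<kappa> = - (a * a)" using 1 by (simp_all add: a_def)
    have "\<bar>r * a / 2\<bar> < 1" using r 1 a by (simp add: a_def field_simps)
    then have t: "tanh (artanh (r * a / 2)) = r * a / 2" by (rule tanh_artanh)
    have "circle_radius \<kappa> r * a = 2 * artanh (r * a / 2)"
      using 1 a by (simp add: circle_radius_def a_def)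
    then have "L0 \<kappa> \<tau> (circle_radius \<kappa> r) = 2 * pi / (a * a) * (2 * (r * a / 2) / (1 - (r * a / 2)\<^sup>2))
        * sqrt (a * a + 4 * \<tau>\<^sup>2 * (r * a / 2)\<^sup>2)"
      using 1 unfolding L0_def a_def[symmetric] by (simp add: sinh_tanh_half t) (simp add: k)
    also have "\<dots> = 2 * pi * cyl_R \<kappa> r * sqrt (1 + \<tau>\<^sup>2 * r\<^sup>2)"
    proof -
      have e: "1 - (r * a / 2)\<^sup>2 = (4 + \<kappa> * r\<^sup>2) / 4" by (simp add: k power2_eq_square field_simps)
      show ?thesis
        unfolding e root[OF less_imp_le[OF a]] cyl_R_def
        using a cyl_denom_pos[OF r] by (simp add: divide_simps)
    qed
    finally show ?thesis .
  next
    case 2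
    then show ?thesis by (simp add: L0_def circle_radius_def cyl_R_def)
  next
    case 3
    define a where "a = sqrt \<kappa>"
    have a: "0 < a" and k: "\<kappa> = a * a" using 3 by (simp_all add: a_def)
    have "circle_radius \<kappa> r * a = 2 * arctan (r * a / 2)"
      using 3 a by (simp add: circle_radius_def a_def)
    then have "L0 \<kappa> \<tau> (circle_radius \<kappa> r) = 2 * pi / (a * a) * (2 * (r * a / 2) / (1 + (r * a / 2)\<^sup>2))
        * sqrt (a * a + 4 * \<tau>\<^sup>2 * (r * a / 2)\<^sup>2)"
      using 3 unfolding L0_def a_def[symmetric] by (simp add: sin_tan_half tan_arctan) (simp add: k)
    also have "\<dots> = 2 * pi * cyl_R \<kappa> r * sqrt (1 + \<tau>\<^sup>2 * r\<^sup>2)"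
    proof -
      have e: "1 + (r * a / 2)\<^sup>2 = (4 + \<kappa> * r\<^sup>2) / 4" by (simp add: k power2_eq_square field_simps)
      show ?thesis
        unfolding e root[OF less_imp_le[OF a]] cyl_R_def
        using a cyl_denom_pos[OF r] by (simp add: divide_simps)
    qed
    finally show ?thesis .
  qed
qed

section \<open>Stability below the bounds and instability beyond them\<close>

lemma has_real_derivative_iterated_sin:
  "((\<lambda>t. k ^ m * sin (k * t + real m * pi / 2)) has_real_derivative
    k ^ Suc m * sin (k * t + real (Suc m) * pi / 2)) (at t within S)"
  by (rule derivative_eq_intros refl | simp)+
     (simp add: sin_add cos_add add_divide_distrib distrib_right)

context
  fixes \<kappa> \<tau> r L :: real and N
  assumes r: "0 < r" "\<kappa> < 0 \<longrightarrow> r < 2 / sqrt (-\<kappa>)" and L: "0 < L"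
    and N: "unit_normal (E_metric \<kappa> \<tau>) (cyl_param \<kappa> r) (cyl_domain \<kappa> r L) N"
begin

text \<open>One argument serves both parts, with k = 1 for strong stability and k = 2 for stability.
  Squaring \<open>le\<close> gives 1/R^2 \<le> c (k pi/L)^2, which is the comparison of potential
  and gradient that the assumed inequality turns into Q \<ge> 0. The inequality is assumed for pairs
  f, f' because it is applied to \<open>D 0\<close> and \<open>D 1\<close>, known to represent
  \<open>u\<close> only on [0, L].\<close>

lemma index_form_nonneg:
  assumes u: "axial_test L u"
    and wirtinger: "\<And>f f'. f 0 = 0 \<Longrightarrow> f L = 0 \<Longrightarrow> (\<And>t. t \<in> {0..L} \<Longrightarrow> f t = u t) \<Longrightarrow>
      (\<And>t. t \<in> {0..L} \<Longrightarrow> (f has_real_derivative f' t) (at t within {0..L})) \<Longrightarrow>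
      continuous_on {0..L} f' \<Longrightarrow>
      (k * pi / L)\<^sup>2 * integral {0..L} (\<lambda>t. (f t)\<^sup>2) \<le> integral {0..L} (\<lambda>t. (f' t)\<^sup>2)"
    and le: "L \<le> k * (pi * cyl_R \<kappa> r * sqrt (1 + \<tau>\<^sup>2 * r\<^sup>2))"
  shows "0 \<le> index_form (E_metric \<kappa> \<tau>) (cyl_param \<kappa> r) (cyl_domain \<kappa> r L) N (\<lambda>(s, t). u t)"
proof -
  let ?R = "cyl_R \<kappa> r" and ?c = "1 + \<tau>\<^sup>2 * r\<^sup>2"
  have R: "0 < ?R" using cyl_R_pos[OF r] .
  have c: "0 < ?c" by (simp add: add_pos_nonneg)
  obtain D where D0: "\<And>t. t \<in> {0..L} \<Longrightarrow> D (0::nat) t = u t"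
    and D: "\<And>n t. t \<in> {0..L} \<Longrightarrow> (D n has_real_derivative D (Suc n) t) (at t within {0..L})"
    using u unfolding axial_test_def smooth_on_interval_def by blast
  have bd: "D 0 0 = 0" "D 0 L = 0" using u D0 L by (auto simp: axial_test_def)
  have cont: "continuous_on {0..L} (D n)" for n
    using D by (intro DERIV_continuous_on)
  define A B where "A = integral {0..L} (\<lambda>t. (D 0 t)\<^sup>2)" and "B = integral {0..L} (\<lambda>t. (D 1 t)\<^sup>2)"
  have A: "((\<lambda>t. (D 0 t)\<^sup>2) has_integral A) {0..L}" and B: "((\<lambda>t. (D 1 t)\<^sup>2) has_integral B) {0..L}"
    unfolding A_def B_def
    by (intro integrable_integral integrable_continuous_interval continuous_intros cont)+
  have "((\<lambda>t. D 0 t * D 1 t) has_real_derivative (D 1 t)\<^sup>2 + D 0 t * D 2 t) (at t within {0..L})"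
    if "t \<in> {0..L}" for t
    using DERIV_mult[OF D[OF that, of 0] D[OF that, of 1]]
    by (simp add: power2_eq_square numeral_2_eq_2 algebra_simps)
  then have "((\<lambda>t. (D 1 t)\<^sup>2 + D 0 t * D 2 t) has_integral D 0 L * D 1 L - D 0 0 * D 1 0) {0..L}"
    using L by (intro fundamental_theorem_of_calculus)
      (auto simp flip: has_real_derivative_iff_has_vector_derivative)
  \<comment> \<open>Integration by parts; the boundary terms vanish by \<open>bd\<close>.\<close>
  then have "((\<lambda>t. D 0 t * D 2 t) has_integral - B) {0..L}"
    using has_integral_diff[OF _ B] by (fastforce simp: bd)
  from has_integral_add[OF has_integral_mult_right[OF this, of ?c] has_integral_mult_right[OF A, of "1 / ?R\<^sup>2"]]
  have "((\<lambda>t. D 0 t * (?c * D 2 t + D 0 t / ?R\<^sup>2)) has_integral A / ?R\<^sup>2 - ?c * B) {0..L}"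
    by (simp add: power2_eq_square algebra_simps)
  then have "index_form (E_metric \<kappa> \<tau>) (cyl_param \<kappa> r) (cyl_domain \<kappa> r L) N (\<lambda>(s, t). u t)
      = 2 * pi * ?R * (?c * B - A / ?R\<^sup>2)"
    using index_form_axial[OF r N D0 D] by (simp add: integral_unique algebra_simps)
  moreover have "A / ?R\<^sup>2 \<le> ?c * B"
  proof -
    have "L\<^sup>2 \<le> (k * (pi * ?R * sqrt ?c))\<^sup>2" using le L by (intro power_mono) auto
    also have "\<dots> = (k * pi)\<^sup>2 * ?R\<^sup>2 * ?c" using c by (simp add: power_mult_distrib)
    finally have "1 / ?R\<^sup>2 \<le> ?c * (k * pi / L)\<^sup>2"
      using L R by (simp add: field_simps)
    moreover have "0 \<le> A" unfolding A_def by (intro integral_nonneg has_integral_integrable[OF A]) auto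
    ultimately have "1 / ?R\<^sup>2 * A \<le> ?c * (k * pi / L)\<^sup>2 * A" by (rule mult_right_mono)
    also have "\<dots> \<le> ?c * B"
      using mult_left_mono[OF wirtinger[OF bd D0 D cont], of ?c] c
      by (simp add: A_def B_def mult.assoc)
    finally show ?thesis by simp
  qed
  ultimately show ?thesis using R by simp
qed

lemma axial_test_sin: "axial_test L (\<lambda>t. sin (real n * pi / L * t))"
proof -
  let ?k = "real n * pi / L"
  show ?thesis
    unfolding axial_test_def smooth_on_interval_def using L has_real_derivative_iterated_sin[of ?k]
    \<comment> \<open>Each derivative multiplies by \<open>?k\<close> and advances the phase by
      pi/2, so one formula gives all derivatives.\<close>
    by (auto intro!: exI[of _ "\<lambda>m t. ?k ^ m * sin (?k * t + real m * pi / 2)"])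
qed

text \<open>The sine is an eigenfunction of the Jacobi operator with factor 1/R^2 - c (n pi/L)^2.
  The hypothesis on L makes this factor positive, and the integral of the squared sine over [0, L]
  is L/2.\<close>

lemma index_form_sin_neg:
  assumes n: "0 < n" and gt: "real n * (pi * cyl_R \<kappa> r * sqrt (1 + \<tau>\<^sup>2 * r\<^sup>2)) < L"
  shows "index_form (E_metric \<kappa> \<tau>) (cyl_param \<kappa> r) (cyl_domain \<kappa> r L) N
    (\<lambda>(s, t). sin (real n * pi / L * t)) < 0"
proof -
  let ?R = "cyl_R \<kappa> r" and ?c = "1 + \<tau>\<^sup>2 * r\<^sup>2" and ?k = "real n * pi / L"
  have R: "0 < ?R" using cyl_R_pos[OF r] .
  have c: "0 < ?c" by (simp add: add_pos_nonneg)
  define D where "D m t = ?k ^ m * sin (?k * t + real m * pi / 2)" for m t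
  have D: "(D m has_real_derivative D (Suc m) t) (at t within {0..L})" for m t
    unfolding D_def by (rule has_real_derivative_iterated_sin)
  have D2: "D 2 t = - ?k\<^sup>2 * D 0 t" for t by (simp add: D_def)
  have "((\<lambda>t. (D 0 t)\<^sup>2) has_integral
      (L / 2 - sin (2 * ?k * L) / (4 * ?k)) - (0 / 2 - sin (2 * ?k * 0) / (4 * ?k))) {0..L}"
  proof (rule fundamental_theorem_of_calculus)
    show "((\<lambda>t. t / 2 - sin (2 * ?k * t) / (4 * ?k)) has_vector_derivative (D 0 t)\<^sup>2) (at t within {0..L})" for t
    proof -
      have "((\<lambda>t. t / 2 - sin (2 * ?k * t) / (4 * ?k)) has_real_derivative
          1 / 2 - cos (2 * ?k * t) * (2 * ?k) / (4 * ?k)) (at t within {0..L})"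
        by (auto intro!: derivative_eq_intros)
      moreover have "1 / 2 - cos (2 * w * t) * (2 * w) / (4 * w) = (sin (w * t))\<^sup>2" if "w \<noteq> 0" for w
        using that cos_double_sin[of "w * t"] by (simp add: mult.assoc) (simp add: field_simps)
      from this[of ?k] have "1 / 2 - cos (2 * ?k * t) * (2 * ?k) / (4 * ?k) = (D 0 t)\<^sup>2"
        using n L by (simp add: D_def)
      ultimately show ?thesis
        by (simp only: has_real_derivative_iff_has_vector_derivative)
    qed
  qed (use L in simp)
  moreover have "sin (2 * ?k * L) = 0"
    using L sin_npi[of "2 * n"] by (simp add: mult_ac)
  ultimately have "((\<lambda>t. (D 0 t)\<^sup>2) has_integral L / 2) {0..L}" by simp
  from has_integral_mult_right[OF this, of "1 / ?R\<^sup>2 - ?c * ?k\<^sup>2"]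
  have "((\<lambda>t. D 0 t * (?c * D 2 t + D 0 t / ?R\<^sup>2)) has_integral (1 / ?R\<^sup>2 - ?c * ?k\<^sup>2) * (L / 2)) {0..L}"
    by (simp add: D2 power2_eq_square algebra_simps)
  then have "index_form (E_metric \<kappa> \<tau>) (cyl_param \<kappa> r) (cyl_domain \<kappa> r L) N (\<lambda>(s, t). sin (?k * t))
      = - (2 * pi * ?R) * ((1 / ?R\<^sup>2 - ?c * ?k\<^sup>2) * (L / 2))"
    by (subst index_form_axial[OF r N, of D]) (auto simp: D integral_unique, simp add: D_def)
  moreover have "?c * ?k\<^sup>2 < 1 / ?R\<^sup>2"
  proof -
    have "(real n * (pi * ?R * sqrt ?c))\<^sup>2 < L\<^sup>2"
      using gt R c by (intro power_strict_mono) auto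
    then have "(real n * pi)\<^sup>2 * ?R\<^sup>2 * ?c < L\<^sup>2" using c by (simp add: power_mult_distrib)
    then show ?thesis using L R by (simp add: field_simps)
  qed
  ultimately show ?thesis using R L by (simp add: mult_pos_pos)
qed

lemma strongly_stable_axial_iff:
  "strongly_stable_axial \<kappa> \<tau> r L N \<longleftrightarrow> L \<le> pi * cyl_R \<kappa> r * sqrt (1 + \<tau>\<^sup>2 * r\<^sup>2)"
proof
  assume "strongly_stable_axial \<kappa> \<tau> r L N"
  then show "L \<le> pi * cyl_R \<kappa> r * sqrt (1 + \<tau>\<^sup>2 * r\<^sup>2)"
    using index_form_sin_neg[of 1] axial_test_sin[of 1]
    unfolding strongly_stable_axial_def by fastforce
next
  assume "L \<le> pi * cyl_R \<kappa> r * sqrt (1 + \<tau>\<^sup>2 * r\<^sup>2)"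
  then show "strongly_stable_axial \<kappa> \<tau> r L N"
    unfolding strongly_stable_axial_def
    using wirtinger_dirichlet[OF L] by (intro allI impI index_form_nonneg[where k=1]) auto
qed

lemma stable_axial_iff:
  "stable_axial \<kappa> \<tau> r L N \<longleftrightarrow> L \<le> 2 * pi * cyl_R \<kappa> r * sqrt (1 + \<tau>\<^sup>2 * r\<^sup>2)"
proof
  \<comment> \<open>The case n = 2 covers a full period, hence has mean zero and is admissible for
    stability.\<close>
  have "((\<lambda>t. sin (2 * pi / L * t)) has_integral
      - cos (2 * pi / L * L) / (2 * pi / L) - - cos (2 * pi / L * 0) / (2 * pi / L)) {0..L}"
    using L
    by (intro fundamental_theorem_of_calculus)
       (auto simp flip: has_real_derivative_iff_has_vector_derivative intro!: derivative_eq_intros)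
  then have "integral {0..L} (\<lambda>t. sin (2 * pi / L * t)) = 0"
    using L by (simp add: integral_unique)
  then have "surface_integral (E_metric \<kappa> \<tau>) (cyl_param \<kappa> r) (cyl_domain \<kappa> r L)
      (\<lambda>(s, t). sin (real 2 * pi / L * t)) = 0"
    by (subst surface_integral_axial[OF r, where f = "\<lambda>t. sin (2 * pi / L * t)"])
       (use L in \<open>auto intro!: continuous_intros\<close>)
  moreover assume "stable_axial \<kappa> \<tau> r L N"
  ultimately show "L \<le> 2 * pi * cyl_R \<kappa> r * sqrt (1 + \<tau>\<^sup>2 * r\<^sup>2)"
    using index_form_sin_neg[of 2] axial_test_sin[of 2]
    unfolding stable_axial_def by fastforce
next
  assume le: "L \<le> 2 * pi * cyl_R \<kappa> r * sqrt (1 + \<tau>\<^sup>2 * r\<^sup>2)"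
  show "stable_axial \<kappa> \<tau> r L N"
    unfolding stable_axial_def
  proof (intro allI impI, elim conjE)
    fix u
    assume u: "axial_test L u"
      and mean: "surface_integral (E_metric \<kappa> \<tau>) (cyl_param \<kappa> r) (cyl_domain \<kappa> r L) (\<lambda>(s, t). u t) = 0"
    show "0 \<le> index_form (E_metric \<kappa> \<tau>) (cyl_param \<kappa> r) (cyl_domain \<kappa> r L) N (\<lambda>(s, t). u t)"
    proof (rule index_form_nonneg[OF u, where k=2])
      fix f f' :: "real \<Rightarrow> real"
      assume f: "f 0 = 0" "f L = 0" "\<And>t. t \<in> {0..L} \<Longrightarrow> f t = u t"
        "\<And>t. t \<in> {0..L} \<Longrightarrow> (f has_real_derivative f' t) (at t within {0..L})"
        "continuous_on {0..L} f'"
      have "surface_integral (E_metric \<kappa> \<tau>) (cyl_param \<kappa> r) (cyl_domain \<kappa> r L) (\<lambda>(s, t). u t)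
          = 2 * pi * cyl_R \<kappa> r * integral {0..L} f"
        using DERIV_continuous_on[OF f(4)] by (rule surface_integral_axial[OF r]) (auto simp: f(3) cyl_domain_def)
      then have "integral {0..L} f = 0" using mean cyl_R_pos[OF r] by simp
      then show "(2 * pi / L)\<^sup>2 * integral {0..L} (\<lambda>t. (f t)\<^sup>2) \<le> integral {0..L} (\<lambda>t. (f' t)\<^sup>2)"
        using wirtinger_periodic[OF L f(4,5)] f(1,2) by simp
    qed (use le in \<open>simp add: mult.assoc\<close>)
  qed
qed

end

theorem corollary4p1:
  fixes \<kappa> \<tau> \<rho> r L :: real and N :: "real \<times> real \<Rightarrow> real^3"
  assumes "0 < \<rho>" and "0 < \<kappa> \<longrightarrow> \<rho> < pi / sqrt \<kappa>"
    and "0 < r" and "\<kappa> < 0 \<longrightarrow> r < 2 / sqrt (-\<kappa>)" and "circle_radius \<kappa> r = \<rho>"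
    and "0 < L"
    and "unit_normal (E_metric \<kappa> \<tau>) (cyl_param \<kappa> r) (cyl_domain \<kappa> r L) N"
  shows "(strongly_stable_axial \<kappa> \<tau> r L N \<longleftrightarrow> L \<le> L0 \<kappa> \<tau> \<rho> / 2) \<and>
         (stable_axial \<kappa> \<tau> r L N \<longleftrightarrow> L \<le> L0 \<kappa> \<tau> \<rho>)"
  using strongly_stable_axial_iff[OF assms(3,4,6,7)] stable_axial_iff[OF assms(3,4,6,7)]
    L0_circle_radius[OF assms(3,4), of \<tau>] assms(5) by (simp add: mult.assoc)

end
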